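(* There exists a universal constant $C>0$ such that the following holds. Let $x>0$. Let $\Theta_0\subset\mathcal B_1$ be a finite set such that $\{\theta\in\mathbb R^d:\|\theta\|_1=1,\|\theta\|_0=1\}\subseteq\Theta_0$. Assume that the losses $(\ell_t)_{t\ge1}$ are Lipschitz with constant $G$, i.e. $\|\nabla\ell_t(\theta)\|_\infty\le G$ for all $t\ge1$ and all $\theta\in\mathcal B_1$, and weakly exp-concave with constants $\alpha>0$ and $\beta\in[0,1]$, i.e. for all $t\ge1$ and all $\theta,\theta'\in\mathcal B_1$, almost surely $$\mathbb E_{t-1}[\ell_t(\theta)-\ell_t(\theta')]\le\mathbb E_{t-1}[\nabla\ell_t(\theta)^\top(\theta-\theta')]-\mathbb E_{t-1}\Big[\big(\alpha(\nabla\ell_t(\theta)^\top(\theta-\theta'))^2\big)^{1/\beta}\Big].$$ Then the Squint / BOA algorithm with multiple constant learning rates (described in the context) applied with grid $\Theta_0$, uniform initial weight vector $\hat\pi_0$ over the elements of $\Theta_0$ and $E=8G/3$ satisfies, with probability at least $1-e^{-x}$, $$R_T(\theta)\le C\left[\left(\frac{a}{\alpha T}\right)^{\frac1{2-\beta}}+G\,D(\theta,\Theta_0)\sqrt{\frac aT}+\frac{aG}{T}\right]\qquad\text{for all }\theta\in\mathcal B_1,$$ where $a=\log\mathrm{Card}(\Theta_0)+\log\log(GT)+x$ and $D(\theta,\Theta_0):=\min_{\theta'\in\Theta_0}D(\theta,\theta')$.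
   Context: Setting. $\mathcal B_1=\{\theta\in\mathbb R^d:\|\theta\|_1\le1\}$; $\|\theta\|_0$ is the number of nonzero coordinates of $\theta$; $\log$ is the natural logarithm; $\Delta_K=\{\pi\in[0,\infty)^K:\sum_k\pi_k=1\}$. The averaging accelerability is defined, for $\theta,\theta'\in\mathcal B_1$, by $$D(\theta,\theta')=\min\{0\le\pi\le1:\|\theta-(1-\pi)\theta'\|_1\le\pi\}.$$ The losses $(\ell_t:\mathbb R^d\to\mathbb R)_{t\ge1}$ are random convex sub-differentiable functions observed sequentially; $\nabla\ell_t(\theta)$ denotes a subgradient of $\ell_t$ at $\theta$. At each time $t\ge1$ the learner forms a prediction $\hat\theta_{t-1}\in\mathbb R^d$ from the past observations $\mathcal F_{t-1}=\{\ell_1,\hat\theta_1,\dots,\ell_{t-1},\hat\theta_{t-1}\}$. Write $\mathbb E_{t-1}=\mathbb E[\,\cdot\,|\mathcal F_{t-1}]$. The average risk is, for $T\ge1$, $$R_T(\theta)=\frac1T\sum_{t=1}^T\mathbb E_{t-1}[\ell_t(\hat\theta_{t-1})]-\frac1T\sum_{t=1}^T\mathbb E_{t-1}[\ell_t(\theta)].$$ The Lipschitz constant $G$ is known. In the weak exp-concavity inequality, for $\beta=0$ the power $1/\beta$ is understood as a limit. Squint / BOA algorithm with multiple constant learning rates. Inputs: a finite grid $\Theta_0=\{\theta_1,\dots,\theta_K\}$, $E>0$, $\hat\pi_0\in\Delta_K$. For integers $1\le i\le\log(ET)$ set $\eta_i=(e^iE)^{-1}$. For $t=1,\dots,T$: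 predict $\hat\theta_{t-1}=\sum_{k=1}^K\hat\pi_{k,t-1}\theta_k$, observe $\nabla\ell_t(\hat\theta_{t-1})$, and update, for $1\le k\le K$, $$\hat\pi_{k,t}=\frac{\sum_{1\le i\le\log(ET)}\eta_ie^{\eta_i\sum_{s=1}^t(r_{k,s}-\eta_ir_{k,s}^2)}\hat\pi_{k,0}}{\sum_{1\le i\le\log(ET)}\sum_{j=1}^K\hat\pi_{j,0}\,\eta_ie^{\eta_i\sum_{s=1}^t(r_{j,s}-\eta_ir_{j,s}^2)}},\qquad r_{k,s}=\nabla\ell_s(\hat\theta_{s-1})^\top(\hat\theta_{s-1}-\theta_k).$$ It is implicit that $GT\ge e$, so that $\log\log(GT)$ is defined and nonnegative and the set of learning rates is nonempty.
   Formalization: The formal theorem additionally assumes G√T ≥ 1; with only GT ≥ e the claim fails (d=1, grid {−1,1}, adversarial linear losses with G=e/T, β=0, α=1/(5G²), x=1: the risk stays above 0.024·G while the claimed bound is o(G)). *)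

theory Defs
  imports "HOL-Probability.Probability"
begin

definition norm_one :: "real ^ 'd \<Rightarrow> real" where
  "norm_one \<theta> = (\<Sum>i\<in>UNIV. \<bar>\<theta> $ i\<bar>)"

definition norm_zero :: "real ^ 'd \<Rightarrow> nat" where
  "norm_zero \<theta> = card {i. \<theta> $ i \<noteq> 0}"

definition unit_ball_one :: "(real ^ 'd) set" where
  "unit_ball_one = {\<theta>. norm_one \<theta> \<le> 1}"

text \<open>The infimum below is attained for points of the unit ball: the set is closed and contains 1.\<close>

definition accelerability :: "real ^ 'd \<Rightarrow> real ^ 'd \<Rightarrow> real" where
  "accelerability \<theta> \<theta>' = Inf {\<pi>. 0 \<le> \<pi> \<and> \<pi> \<le> 1 \<and> norm_one (\<theta> - (1 - \<pi>) *\<^sub>R \<theta>') \<le> \<pi>}"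

definition accelerability_set :: "real ^ 'd \<Rightarrow> (real ^ 'd) set \<Rightarrow> real" where
  "accelerability_set \<theta> \<Theta> = Min (accelerability \<theta> ` \<Theta>)"

definition subdifferential :: "(real ^ 'd \<Rightarrow> real) \<Rightarrow> real ^ 'd \<Rightarrow> (real ^ 'd) set" where
  "subdifferential f \<theta> = {g. \<forall>\<theta>'. f \<theta> + g \<bullet> (\<theta>' - \<theta>) \<le> f \<theta>'}"


text \<open>
  The algorithm is deterministic given the subgradients: \<open>gr t \<theta>\<close> stands for the chosen
  subgradient of the \<open>t\<close>-th loss at \<open>\<theta>\<close>.  Weight vectors are indexed by the grid points
  themselves instead of by \<open>1, \<dots>, K\<close>.
\<close>

definition rate_indices :: "real \<Rightarrow> nat \<Rightarrow> nat set" where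
  "rate_indices E T = {i. 1 \<le> i \<and> real i \<le> ln (E * real T)}"

definition learning_rate :: "real \<Rightarrow> nat \<Rightarrow> real" where
  "learning_rate E i = inverse (exp (real i) * E)"

definition squint_potential ::
  "real \<Rightarrow> nat \<Rightarrow> (nat \<Rightarrow> 'v \<Rightarrow> real) \<Rightarrow> nat \<Rightarrow> 'v \<Rightarrow> real" where
  "squint_potential E T r t \<theta> =
     (\<Sum>i\<in>rate_indices E T. learning_rate E i *
        exp (learning_rate E i * (\<Sum>s\<in>{1..t}. r s \<theta> - learning_rate E i * (r s \<theta>)\<^sup>2)))"

definition squint_weight ::
  "'v set \<Rightarrow> real \<Rightarrow> nat \<Rightarrow> ('v \<Rightarrow> real) \<Rightarrow> (nat \<Rightarrow> 'v \<Rightarrow> real) \<Rightarrow> nat \<Rightarrow> 'v \<Rightarrow> real" where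
  "squint_weight \<Theta> E T \<pi>0 r t \<theta> =
     (if t = 0 then \<pi>0 \<theta>
      else squint_potential E T r t \<theta> * \<pi>0 \<theta> /
           (\<Sum>\<theta>'\<in>\<Theta>. squint_potential E T r t \<theta>' * \<pi>0 \<theta>'))"

lemma squint_weight_cong [fundef_cong]:
  assumes "\<Theta> = \<Theta>'" "E = E'" "T = T'" "\<pi>0 = \<pi>0'" "t = t'" "\<theta> = \<theta>'"
    and "\<And>s v. s \<in> {1..t'} \<Longrightarrow> r s v = r' s v"
  shows "squint_weight \<Theta> E T \<pi>0 r t \<theta> = squint_weight \<Theta>' E' T' \<pi>0' r' t' \<theta>'"
proof -
  have "squint_potential E' T' r t' v = squint_potential E' T' r' t' v" for v
    unfolding squint_potential_def using assms(7) by (intro sum.cong refl) simp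
  then show ?thesis
    using assms(1-6) by (simp add: squint_weight_def)
qed

text \<open>
  \<open>squint_prediction \<Theta> E T \<pi>0 gr t\<close> is the point predicted after \<open>t\<close> observations,
  so that the loss of round \<open>t \<ge> 1\<close> is suffered at \<open>squint_prediction \<Theta> E T \<pi>0 gr (t - 1)\<close>.
\<close>

function squint_prediction ::
  "(real ^ 'd) set \<Rightarrow> real \<Rightarrow> nat \<Rightarrow> (real ^ 'd \<Rightarrow> real) \<Rightarrow> (nat \<Rightarrow> real ^ 'd \<Rightarrow> real ^ 'd) \<Rightarrow>
    nat \<Rightarrow> real ^ 'd" where
  "squint_prediction \<Theta> E T \<pi>0 gr t =
     (\<Sum>\<theta>\<in>\<Theta>. squint_weight \<Theta> E T \<pi>0
        (\<lambda>s v. gr s (squint_prediction \<Theta> E T \<pi>0 gr (s - 1)) \<bullet>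
                (squint_prediction \<Theta> E T \<pi>0 gr (s - 1) - v)) t \<theta> *\<^sub>R \<theta>)"
  by pat_completeness auto
termination
  by (relation "Wellfounded.measure (\<lambda>(\<Theta>, E, T, \<pi>0, gr, t). t)") auto

declare squint_prediction.simps [simp del]

definition uniform_weight :: "'v set \<Rightarrow> 'v \<Rightarrow> real" where
  "uniform_weight \<Theta> \<theta> = 1 / real (card \<Theta>)"


text \<open>
  In the random setting \<open>loss t \<omega>\<close> and \<open>grad t \<omega>\<close> are the \<open>t\<close>-th loss and its selected
  subgradients, and \<open>pred t \<omega>\<close> is the prediction made after \<open>t\<close> observations.  The past
  \<open>history M loss pred t\<close> is generated by \<open>loss 1, pred 1, \<dots>, loss t, pred t\<close>, a random
  function being observed through all its values.
\<close>

definition history ::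
  "'w measure \<Rightarrow> (nat \<Rightarrow> 'w \<Rightarrow> real ^ 'd \<Rightarrow> real) \<Rightarrow> (nat \<Rightarrow> 'w \<Rightarrow> real ^ 'd) \<Rightarrow> nat \<Rightarrow> 'w measure" where
  "history M loss pred t = sigma (space M)
     (\<Union>s\<in>{1..t}. {(\<lambda>\<omega>. loss s \<omega> \<theta>) -` B \<inter> space M | \<theta> B. B \<in> sets borel} \<union>
                  {pred s -` B \<inter> space M | B. B \<in> sets borel})"

text \<open>
  Joint measurability and integrability are what is needed for the conditional expectations
  of \<open>loss t\<close> and \<open>grad t\<close>, at fixed points and at random predictions, to make sense.
\<close>

definition random_convex_losses ::
  "'w measure \<Rightarrow> (nat \<Rightarrow> 'w \<Rightarrow> real ^ 'd \<Rightarrow> real) \<Rightarrow> (nat \<Rightarrow> 'w \<Rightarrow> real ^ 'd \<Rightarrow> real ^ 'd) \<Rightarrow> bool" where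
  "random_convex_losses M loss grad \<longleftrightarrow>
     (\<forall>t\<ge>1.
        (\<forall>\<theta>. (\<lambda>\<omega>. loss t \<omega> \<theta>) \<in> borel_measurable M) \<and>
        (\<forall>\<theta>\<in>unit_ball_one. integrable M (\<lambda>\<omega>. loss t \<omega> \<theta>)) \<and>
        (\<lambda>(\<omega>, \<theta>). grad t \<omega> \<theta>) \<in> borel_measurable (M \<Otimes>\<^sub>M borel) \<and>
        (\<forall>\<omega>\<in>space M. convex_on UNIV (loss t \<omega>) \<and>
           (\<forall>\<theta>. grad t \<omega> \<theta> \<in> subdifferential (loss t \<omega>) \<theta>)))"

definition lipschitz_losses ::
  "'w measure \<Rightarrow> (nat \<Rightarrow> 'w \<Rightarrow> real ^ 'd \<Rightarrow> real ^ 'd) \<Rightarrow> real \<Rightarrow> bool" where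
  "lipschitz_losses M grad G \<longleftrightarrow>
     (\<forall>t\<ge>1. AE \<omega> in M. \<forall>\<theta>\<in>unit_ball_one. infnorm (grad t \<omega> \<theta>) \<le> G)"

text \<open>
  \<open>y\<close> to the power \<open>1 / \<beta>\<close> for \<open>y \<ge> 0\<close>.  At \<open>\<beta> = 0\<close> the limit is 0, 1 or \<open>\<infinity>\<close> according to
  whether \<open>y < 1\<close>, \<open>y = 1\<close> or \<open>y > 1\<close>, hence the extended codomain.
\<close>

definition inverse_power :: "real \<Rightarrow> real \<Rightarrow> ennreal" where
  "inverse_power \<beta> y =
     (if \<beta> = 0 then Lim (at_right 0) (\<lambda>b. ennreal (y powr (1 / b))) else ennreal (y powr (1 / \<beta>)))"

definition weakly_exp_concave ::
  "'w measure \<Rightarrow> (nat \<Rightarrow> 'w measure) \<Rightarrow> (nat \<Rightarrow> 'w \<Rightarrow> real ^ 'd \<Rightarrow> real) \<Rightarrow>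
    (nat \<Rightarrow> 'w \<Rightarrow> real ^ 'd \<Rightarrow> real ^ 'd) \<Rightarrow> real \<Rightarrow> real \<Rightarrow> bool" where
  "weakly_exp_concave M F loss grad \<alpha> \<beta> \<longleftrightarrow>
     (\<forall>t\<ge>1. \<forall>\<theta>\<in>unit_ball_one. \<forall>\<theta>'\<in>unit_ball_one. AE \<omega> in M.
        ereal (real_cond_exp M (F (t - 1)) (\<lambda>\<omega>. loss t \<omega> \<theta> - loss t \<omega> \<theta>') \<omega>)
        \<le> ereal (real_cond_exp M (F (t - 1)) (\<lambda>\<omega>. grad t \<omega> \<theta> \<bullet> (\<theta> - \<theta>')) \<omega>)
          - enn2ereal (nn_cond_exp M (F (t - 1))
              (\<lambda>\<omega>. inverse_power \<beta> (\<alpha> * (grad t \<omega> \<theta> \<bullet> (\<theta> - \<theta>'))\<^sup>2)) \<omega>))"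

definition average_risk ::
  "'w measure \<Rightarrow> (nat \<Rightarrow> 'w measure) \<Rightarrow> (nat \<Rightarrow> 'w \<Rightarrow> real ^ 'd \<Rightarrow> real) \<Rightarrow>
    (nat \<Rightarrow> 'w \<Rightarrow> real ^ 'd) \<Rightarrow> nat \<Rightarrow> real ^ 'd \<Rightarrow> 'w \<Rightarrow> real" where
  "average_risk M F loss pred T \<theta> \<omega> =
     1 / real T * (\<Sum>t\<in>{1..T}. real_cond_exp M (F (t - 1)) (\<lambda>\<omega>. loss t \<omega> (pred (t - 1) \<omega>)) \<omega>)
     - 1 / real T * (\<Sum>t\<in>{1..T}. real_cond_exp M (F (t - 1)) (\<lambda>\<omega>. loss t \<omega> \<theta>) \<omega>)"

text \<open>
  "With probability at least \<open>p\<close>, \<open>X \<theta> \<le> b \<theta>\<close> for all \<open>\<theta> \<in> S\<close>", for a family of random variables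
  each of which is only determined up to a null set, as conditional expectations are.  The
  event \<open>A\<close> does not depend on \<open>\<theta>\<close>.  The order "for all \<open>\<theta>\<close>, almost surely on \<open>A\<close>" makes the
  notion independent of the chosen versions \<open>X \<theta>\<close>; an uncountable quantifier inside the
  almost-sure statement would depend on them.
\<close>

definition with_probability_uniformly ::
  "'w measure \<Rightarrow> real \<Rightarrow> 'v set \<Rightarrow> ('v \<Rightarrow> 'w \<Rightarrow> real) \<Rightarrow> ('v \<Rightarrow> real) \<Rightarrow> bool" where
  "with_probability_uniformly M p S X b \<longleftrightarrow>
     (\<exists>A\<in>sets M. p \<le> measure M A \<and> (\<forall>\<theta>\<in>S. AE \<omega> in M. \<omega> \<in> A \<longrightarrow> X \<theta> \<omega> \<le> b \<theta>))"

text \<open>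
  A universal constant \<open>C\<close> must not depend on the dimension or on the probability space.  These
  are type parameters, over which a formula \<open>\<exists>C. \<dots>\<close> cannot quantify internally; bounding
  \<open>C\<close> by a fixed number, whose value is immaterial, restores the uniformity.
\<close>

definition universal_cap :: real where
  "universal_cap = 10 ^ 9"

end

theory Submission
  imports Defs
begin

text \<open>
  Let \<open>r t k\<close> be the linearised regret against the grid point \<open>k\<close> in round \<open>t\<close>, let \<open>G\<close> bound the
  gradients, and let \<open>\<E>\<close> be the expectation given the past of the round.

  The weights of Squint make the sum over \<open>k\<close> and the rates \<open>\<eta>\<close> of
  \<open>exp (\<eta> * \<Sum>(r - \<eta> * r\<^sup>2))\<close> nonincreasing, because \<open>exp (y - y\<^sup>2) \<le> 1 + y\<close>.  This bounds
  \<open>\<Sum>(r - \<eta> * r\<^sup>2)\<close> by \<open>ln (m * K) / \<eta>\<close> for each of the \<open>K\<close> grid points and \<open>m\<close> rates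
  (\<open>squint_regret_bound\<close>).  The risk is about conditional means, and they are reached by the same
  exponential bound: for small \<open>u\<close>, \<open>exp (\<E> u - u + u\<^sup>2 - 3 * \<E> u\<^sup>2)\<close> has conditional mean at most
  1.  With \<open>u = \<eta> * r\<close>, the term \<open>- u + u\<^sup>2\<close> is exactly what the regret bound cancels.  The
  product over the rounds is a supermartingale, and Markov's inequality for its sum over \<open>k\<close> and
  \<open>\<eta>\<close> gives one event of probability at least \<open>1 - exp (- x)\<close> on which, for all \<open>k\<close> and \<open>\<eta>\<close>,
  \<open>\<Sum>(\<E> r - 3 * \<eta> * \<E> r\<^sup>2) \<le> 4 * a / \<eta>\<close> (\<open>conditional_regret_event\<close>).

  Weak exp-concavity absorbs the quadratic term.  Let \<open>Y\<close> be the linearised regret against an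
  arbitrary \<open>\<theta>\<close>.  By Young's inequality the expected excess loss is at most
  \<open>\<E> Y - \<lambda> * \<E> Y\<^sup>2 + c\<close> as soon as \<open>\<lambda> \<le> \<alpha> * c powr (1 - \<beta>)\<close>.  The choice
  \<open>c = (a / (\<alpha> * T)) powr (1 / (2 - \<beta>))\<close> balances \<open>c\<close> with \<open>a / (\<lambda> * T)\<close>, the price of a rate of
  order \<open>\<lambda>\<close>.  The hypothesis speaks of deterministic points, whereas the prediction \<open>P\<close> is random and
  the gradients may jump at \<open>P\<close>.  The inequality is carried over by approximating \<open>P\<close>
  from the side of \<open>\<theta>\<close>, where monotonicity of subgradients has the right sign; the price is the
  restriction \<open>\<lambda> \<le> 1 / (4 * G)\<close> (\<open>cond_exp_excess_loss_le\<close>).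

  Finally \<open>\<theta> = (1 - D) \<theta>' + v\<close> with \<open>\<theta>'\<close> in the grid, \<open>D\<close> the accelerability, and \<open>v\<close> a
  combination of vertices of the ball of total weight \<open>D\<close>.  The vertices are charged the slow
  rate, which costs an amount of order \<open>D * G * sqrt (a / T)\<close> in total.  For \<open>\<theta>'\<close> one uses a rate of
  the order of the smallest of \<open>1 / G\<close>, \<open>\<lambda>\<close> and \<open>sqrt (a / T) / (G * D)\<close>: the first two let \<open>- \<lambda> * \<E> Y\<^sup>2\<close>
  absorb the part of \<open>\<E> r\<^sup>2\<close> that is comparable with \<open>\<E> Y\<^sup>2\<close>, and the last one keeps the remaining
  part, of order \<open>\<eta> * D\<^sup>2 * G\<^sup>2\<close>, below \<open>D * G * sqrt (a / T)\<close> (\<open>tuned_regret_bound\<close>).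
\<close>

section \<open>The unit ball of the 1-norm and accelerability\<close>

lemma norm_one_triangle: "norm_one (u + v) \<le> norm_one u + norm_one v"
  unfolding norm_one_def sum.distrib[symmetric] by (intro sum_mono) simp

lemma norm_one_scaleR: "norm_one (c *\<^sub>R v) = \<bar>c\<bar> * norm_one v"
  by (simp add: norm_one_def abs_mult sum_distrib_left)

lemma norm_one_nonneg: "0 \<le> norm_one v"
  by (simp add: norm_one_def sum_nonneg)

lemma norm_one_zero [simp]: "norm_one 0 = 0"
  by (simp add: norm_one_def)

lemma norm_one_minus: "norm_one (- v) = norm_one v"
  by (simp add: norm_one_def)

lemma norm_one_diff_le: "norm_one (u - v) \<le> norm_one u + norm_one v"
  using norm_one_triangle[of u "- v"] by (simp add: norm_one_minus)

lemma norm_one_eq_0_iff: "norm_one v = 0 \<longleftrightarrow> v = 0"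
  by (auto simp: norm_one_def sum_nonneg_eq_0_iff vec_eq_iff)

lemma norm_one_le_card_norm:
  fixes v :: "real ^ 'd"
  shows "norm_one v \<le> real CARD('d) * norm v"
proof -
  have "norm_one v \<le> (\<Sum>i\<in>(UNIV :: 'd set). norm v)"
    unfolding norm_one_def by (intro sum_mono component_le_norm_cart)
  then show ?thesis by simp
qed

lemma norm_le_norm_one: "norm v \<le> norm_one v"
  unfolding norm_one_def by (rule norm_le_l1_cart)

lemma abs_inner_le_infnorm_norm_one:
  fixes g v :: "real ^ 'd"
  shows "\<bar>g \<bullet> v\<bar> \<le> infnorm g * norm_one v"
proof -
  have "\<bar>g \<bullet> v\<bar> \<le> (\<Sum>i\<in>UNIV. \<bar>g $ i * v $ i\<bar>)"
    unfolding inner_vec_def by (simp add: sum_abs)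
  also have "\<dots> \<le> (\<Sum>i\<in>UNIV. infnorm g * \<bar>v $ i\<bar>)"
    by (intro sum_mono) (simp add: abs_mult mult_right_mono component_le_infnorm_cart)
  finally show ?thesis by (simp add: norm_one_def sum_distrib_left)
qed

lemma abs_inner_le_norm_one:
  assumes "infnorm g \<le> G" "norm_one v \<le> c" "0 \<le> c"
  shows "\<bar>g \<bullet> v\<bar> \<le> G * c"
  using abs_inner_le_infnorm_norm_one[of g v] mult_mono[OF assms(1,2) _ norm_one_nonneg]
    order_trans[OF infnorm_pos_le assms(1)] by linarith

lemma abs_inner_diff_le_unit_ball_one:
  assumes "infnorm g \<le> G" "u \<in> unit_ball_one" "v \<in> unit_ball_one"
  shows "\<bar>g \<bullet> (u - v)\<bar> \<le> 2 * G"
proof -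
  have "norm_one (u - v) \<le> 2"
    using norm_one_diff_le[of u v] assms(2,3) by (simp add: unit_ball_one_def)
  from abs_inner_le_norm_one[OF assms(1) this] show ?thesis by simp
qed

lemma continuous_on_norm_one [continuous_intros]: "continuous_on S norm_one"
  unfolding norm_one_def[abs_def] by (intro continuous_intros)

lemma zero_in_unit_ball_one: "0 \<in> unit_ball_one"
  by (simp add: unit_ball_one_def)

lemma convex_unit_ball_one: "convex (unit_ball_one :: (real ^ 'd) set)"
proof (rule convexI)
  fix x y :: "real ^ 'd" and u v :: real
  assume *: "x \<in> unit_ball_one" "y \<in> unit_ball_one" "0 \<le> u" "0 \<le> v" "u + v = 1"
  have "norm_one (u *\<^sub>R x + v *\<^sub>R y) \<le> u * norm_one x + v * norm_one y"
    using norm_one_triangle[of "u *\<^sub>R x" "v *\<^sub>R y"] * by (simp add: norm_one_scaleR)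
  also have "\<dots> \<le> u * 1 + v * 1"
    using * by (intro add_mono mult_left_mono) (auto simp: unit_ball_one_def)
  finally show "u *\<^sub>R x + v *\<^sub>R y \<in> unit_ball_one" using * by (simp add: unit_ball_one_def)
qed

lemma compact_unit_ball_one: "compact (unit_ball_one :: (real ^ 'd) set)"
proof -
  have "closed (unit_ball_one :: (real ^ 'd) set)"
    unfolding unit_ball_one_def by (intro closed_Collect_le continuous_intros)
  moreover have "bounded (unit_ball_one :: (real ^ 'd) set)"
    unfolding bounded_iff unit_ball_one_def using norm_le_norm_one order_trans by blast
  ultimately show ?thesis by (simp add: compact_eq_bounded_closed)
qed

lemma signed_axis_is_vertex:
  assumes "\<bar>s\<bar> = 1"
  shows "axis i s \<in> {\<theta> :: real ^ 'd. norm_one \<theta> = 1 \<and> norm_zero \<theta> = 1}"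
proof -
  have "{j. axis i s $ j \<noteq> 0} = {i}" using assms by (auto simp: axis_def)
  moreover have "norm_one (axis i s) = 1"
    using assms by (simp add: norm_one_def axis_def if_distrib[of abs] cong: if_cong)
  ultimately show ?thesis by (simp add: norm_zero_def)
qed

lemma two_le_card_vertices:
  assumes "finite \<Theta>" "{\<theta> :: real ^ 'd. norm_one \<theta> = 1 \<and> norm_zero \<theta> = 1} \<subseteq> \<Theta>"
  shows "2 \<le> card \<Theta>"
proof -
  obtain i :: 'd where True by simp
  have sub: "{axis i 1, axis i (- 1)} \<subseteq> \<Theta>"
    using assms(2) signed_axis_is_vertex[of 1 i] signed_axis_is_vertex[of "- 1" i] by auto
  have "(axis i 1 :: real ^ 'd) \<noteq> axis i (- 1)" by (simp add: axis_eq_axis)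
  then have "card {axis i 1, axis i (- 1) :: real ^ 'd} = 2" by simp
  then show ?thesis using card_mono[OF assms(1) sub] by simp
qed

text \<open>
  A coordinate \<open>v $ i\<close> is split between the vertices \<open>\<plusminus> axis i 1\<close>.  The slack
  \<open>1 - norm_one v\<close> is spread evenly over opposite vertices, where it cancels.
\<close>

lemma unit_ball_one_subset_convex_hull_vertices:
  "(unit_ball_one :: (real ^ 'd) set) \<subseteq> convex hull {\<theta>. norm_one \<theta> = 1 \<and> norm_zero \<theta> = 1}"
proof
  fix v :: "real ^ 'd" assume v: "v \<in> unit_ball_one"
  define q where "q i = \<bar>v $ i\<bar> + (1 - norm_one v) / real CARD('d)" for i
  define s :: "bool \<Rightarrow> real" where "s b = (if b then 1 else - 1)" for b
  define w where "w ib = (q (fst ib) + s (snd ib) * v $ fst ib) / 2" for ib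
  let ?V = "{\<theta> :: real ^ 'd. norm_one \<theta> = 1 \<and> norm_zero \<theta> = 1}"
  have q: "\<bar>v $ i\<bar> \<le> q i" for i using v by (simp add: q_def unit_ball_one_def)
  have sumq: "sum q UNIV = 1" by (simp add: q_def sum.distrib norm_one_def)
  have split: "(\<Sum>ib\<in>UNIV \<times> UNIV. f ib) = (\<Sum>i\<in>UNIV. f (i, True) + f (i, False))"
    for f :: "'d \<times> bool \<Rightarrow> 'b :: comm_monoid_add"
    by (simp add: sum.cartesian_product' UNIV_bool add.commute)
  have "(\<Sum>ib\<in>UNIV \<times> UNIV. w ib *\<^sub>R (axis (fst ib) (s (snd ib)) :: real ^ 'd)) \<in> convex hull ?V"
  proof (rule convex_sum)
    show "sum w (UNIV \<times> UNIV) = 1"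
      unfolding split by (simp add: w_def s_def sumq field_simps sum_divide_distrib[symmetric])
    show "0 \<le> w ib" for ib using q[of "fst ib"] by (auto simp: w_def s_def)
    show "axis (fst ib) (s (snd ib)) \<in> convex hull ?V" for ib
      by (rule hull_inc, rule signed_axis_is_vertex) (simp add: s_def)
  qed auto
  also have "(\<Sum>ib\<in>UNIV \<times> UNIV. w ib *\<^sub>R (axis (fst ib) (s (snd ib)) :: real ^ 'd)) = v"
  proof -
    have "w (i, True) *\<^sub>R axis i (s True) + w (i, False) *\<^sub>R axis i (s False) = axis i (v $ i)" for i
      by (auto simp: vec_eq_iff axis_def w_def s_def field_simps)
    then have "(\<Sum>ib\<in>UNIV \<times> UNIV. w ib *\<^sub>R (axis (fst ib) (s (snd ib)) :: real ^ 'd))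
        = (\<Sum>i\<in>UNIV. axis i (v $ i))"
      unfolding split by simp
    also have "\<dots> = v" by (simp add: vec_eq_iff axis_def)
    finally show ?thesis .
  qed
  finally show "v \<in> convex hull ?V" .
qed

text \<open>
  The set in the definition is compact, so the infimum belongs to it.  The value 1 makes the set
  nonempty because \<open>\<theta>\<close> lies in the ball.
\<close>

lemma accelerability_attained:
  fixes \<theta> \<theta>' :: "real ^ 'd"
  assumes "\<theta> \<in> unit_ball_one"
  shows "0 \<le> accelerability \<theta> \<theta>'" "accelerability \<theta> \<theta>' \<le> 1"
    "norm_one (\<theta> - (1 - accelerability \<theta> \<theta>') *\<^sub>R \<theta>') \<le> accelerability \<theta> \<theta>'"
proof -
  let ?S = "{\<pi>. 0 \<le> \<pi> \<and> \<pi> \<le> 1 \<and> norm_one (\<theta> - (1 - \<pi>) *\<^sub>R \<theta>') \<le> \<pi>}"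
  have cont: "continuous_on UNIV (\<lambda>\<pi>. norm_one (\<theta> - (1 - \<pi>) *\<^sub>R \<theta>'))"
    unfolding norm_one_def by (intro continuous_intros)
  have "closed ?S"
    by (intro closed_Collect_conj closed_Collect_le cont continuous_intros)
  moreover have "?S \<noteq> {}" using assms by (auto simp: unit_ball_one_def intro!: exI[of _ 1])
  moreover have "bdd_below ?S" by (rule bdd_belowI[of _ 0]) auto
  ultimately have "Inf ?S \<in> ?S" by (intro closed_contains_Inf)
  then show "0 \<le> accelerability \<theta> \<theta>'" "accelerability \<theta> \<theta>' \<le> 1"
    "norm_one (\<theta> - (1 - accelerability \<theta> \<theta>') *\<^sub>R \<theta>') \<le> accelerability \<theta> \<theta>'"
    by (auto simp: accelerability_def)
qed

text \<open>
  The weights sum to the radius \<open>D\<close> itself, even where \<open>v\<close> lies inside the ball of radius \<open>D\<close>: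
  opposite vertices can take up the slack.
\<close>

lemma scaled_ball_grid_combination:
  fixes v :: "real ^ 'd"
  assumes "finite \<Theta>" "{\<theta>. norm_one \<theta> = 1 \<and> norm_zero \<theta> = 1} \<subseteq> \<Theta>" "norm_one v \<le> D"
  shows "\<exists>p. (\<forall>k\<in>\<Theta>. 0 \<le> p k) \<and> sum p \<Theta> = D \<and> (\<Sum>k\<in>\<Theta>. p k *\<^sub>R k) = v"
proof (cases "D = 0")
  case True
  then have "v = 0" using assms(3) norm_one_nonneg[of v] by (simp add: norm_one_eq_0_iff)
  then show ?thesis using True by (intro exI[of _ "\<lambda>_. 0"]) auto
next
  case False
  then have D: "0 < D" using assms(3) norm_one_nonneg[of v] by linarith
  have "v /\<^sub>R D \<in> unit_ball_one"
    using assms(3) D by (simp add: unit_ball_one_def norm_one_scaleR field_simps)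
  then have "v /\<^sub>R D \<in> convex hull \<Theta>"
    using unit_ball_one_subset_convex_hull_vertices hull_mono[OF assms(2)] by blast
  then obtain u where u: "\<forall>k\<in>\<Theta>. 0 \<le> u k" "sum u \<Theta> = 1" "(\<Sum>k\<in>\<Theta>. u k *\<^sub>R k) = v /\<^sub>R D"
    unfolding convex_hull_finite[OF assms(1)] by blast
  show ?thesis
  proof (intro exI[of _ "\<lambda>k. D * u k"] conjI)
    show "(\<Sum>k\<in>\<Theta>. (D * u k) *\<^sub>R k) = v"
      using arg_cong[OF u(3), of "\<lambda>x. D *\<^sub>R x"] D by (simp add: scaleR_sum_right)
  qed (use u D in \<open>auto simp: sum_distrib_left[symmetric]\<close>)
qed

text \<open>
  This is the only way in which accelerability enters: apart from the single grid point \<open>\<theta>'\<close>, all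
  the mass, of total amount \<open>D\<close>, may be charged a slow rate.
\<close>

lemma accelerability_set_decomposition:
  fixes \<theta> :: "real ^ 'd"
  assumes "finite \<Theta>" "{\<theta>. norm_one \<theta> = 1 \<and> norm_zero \<theta> = 1} \<subseteq> \<Theta>" "\<theta> \<in> unit_ball_one"
  defines "D \<equiv> accelerability_set \<theta> \<Theta>"
  obtains \<theta>' p where "\<theta>' \<in> \<Theta>" "0 \<le> D" "D \<le> 1" "\<And>k. k \<in> \<Theta> \<Longrightarrow> 0 \<le> p k" "sum p \<Theta> = D"
    "\<theta> = (1 - D) *\<^sub>R \<theta>' + (\<Sum>k\<in>\<Theta>. p k *\<^sub>R k)"
proof -
  have ne: "\<Theta> \<noteq> {}" using two_le_card_vertices[OF assms(1,2)] by auto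
  then have "D \<in> accelerability \<theta> ` \<Theta>"
    unfolding D_def accelerability_set_def using assms(1) by (intro Min_in) auto
  then obtain \<theta>' where \<theta>': "\<theta>' \<in> \<Theta>" "D = accelerability \<theta> \<theta>'" by auto
  note att = accelerability_attained[OF assms(3), of \<theta>', folded \<theta>'(2)]
  obtain p where "\<forall>k\<in>\<Theta>. 0 \<le> p k" "sum p \<Theta> = D"
    "(\<Sum>k\<in>\<Theta>. p k *\<^sub>R k) = \<theta> - (1 - D) *\<^sub>R \<theta>'"
    using scaled_ball_grid_combination[OF assms(1,2) att(3)] by blast
  then show thesis using that[of \<theta>' p] \<theta>'(1) att(1,2) by (simp add: algebra_simps)
qed

section \<open>Pathwise regret of Squint\<close>

text \<open>
  The difference \<open>ln (1 + x) - x + x\<^sup>2\<close> has derivative \<open>x * (1 + 2 * x) / (1 + x)\<close>, hence a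
  minimum at 0 on the interval in question.
\<close>

lemma exp_minus_square_le:
  fixes x :: real
  assumes "- 1 / 2 \<le> x"
  shows "exp (x - x\<^sup>2) \<le> 1 + x"
proof -
  define f where "f x = ln (1 + x) - x + x\<^sup>2" for x :: real
  have der: "(f has_real_derivative x * (1 + 2 * x) / (1 + x)) (at x)" if "- 1 / 2 \<le> x" for x
    unfolding f_def using that
    by (auto intro!: derivative_eq_intros simp: field_simps power2_eq_square)
  have "0 \<le> f x"
  proof (cases "0 \<le> x")
    case True
    have "f 0 \<le> f x"
    proof (rule DERIV_nonneg_imp_nondecreasing[OF True])
      fix y assume "0 \<le> y" "y \<le> x"
      then show "\<exists>d. (f has_real_derivative d) (at y) \<and> 0 \<le> d"
        using assms by (intro exI[of _ "y * (1 + 2 * y) / (1 + y)"] conjI der) auto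
    qed
    then show ?thesis by (simp add: f_def)
  next
    case False
    have "f x \<ge> f 0"
    proof (rule DERIV_nonpos_imp_nonincreasing[of x 0])
      fix y assume "x \<le> y" "y \<le> 0"
      then show "\<exists>d. (f has_real_derivative d) (at y) \<and> d \<le> 0"
        using assms by (intro exI[of _ "y * (1 + 2 * y) / (1 + y)"] conjI der) (auto intro!: divide_nonpos_pos mult_nonpos_nonneg)
    qed (use False in auto)
    then show ?thesis by (simp add: f_def)
  qed
  then have "x - x\<^sup>2 \<le> ln (1 + x)" by (simp add: f_def)
  then have "exp (x - x\<^sup>2) \<le> exp (ln (1 + x))" by simp
  then show ?thesis using assms by simp
qed

lemma finite_rate_indices: "finite (rate_indices E T)"
proof (rule finite_subset)
  show "rate_indices E T \<subseteq> {..nat \<lfloor>ln (E * real T)\<rfloor>}"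
    by (auto simp: rate_indices_def le_nat_floor)
qed simp

lemma card_rate_indices_le:
  assumes "0 \<le> ln (E * real T)"
  shows "real (card (rate_indices E T)) \<le> ln (E * real T)"
proof -
  have "rate_indices E T \<subseteq> {1..nat \<lfloor>ln (E * real T)\<rfloor>}"
    by (auto simp: rate_indices_def le_nat_floor)
  then have "card (rate_indices E T) \<le> nat \<lfloor>ln (E * real T)\<rfloor>"
    using card_mono[of "{1..nat \<lfloor>ln (E * real T)\<rfloor>}" "rate_indices E T"] by simp
  then have "real (card (rate_indices E T)) \<le> real (nat \<lfloor>ln (E * real T)\<rfloor>)" by simp
  also have "\<dots> \<le> ln (E * real T)" using assms by (rule of_nat_floor)
  finally show ?thesis .
qed

lemma learning_rate_pos: "0 < E \<Longrightarrow> 0 < learning_rate E i"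
  by (simp add: learning_rate_def)

text \<open>
  The largest rate is \<open>3 / (8 * exp 1 * G)\<close>, and \<open>3 / (4 * exp 1) \<le> 1 / 3\<close>.
\<close>

lemma abs_learning_rate_mult_le:
  assumes "i \<in> rate_indices E T" "E = 8 * G / 3" "0 < G" "\<bar>r\<bar> \<le> 2 * G"
  shows "\<bar>learning_rate E i * r\<bar> \<le> 1 / 3"
proof -
  have "9 / 4 \<le> exp (1 :: real)" using e_approx_32 by (simp add: abs_if split: if_splits)
  also have "\<dots> \<le> exp (real i)" using assms(1) by (simp add: rate_indices_def)
  finally have "9 / 4 * E \<le> exp (real i) * E" using assms(2,3) by (intro mult_right_mono) auto
  then have "6 * G \<le> exp (real i) * E" by (simp add: assms(2))
  then have "3 * \<bar>r\<bar> \<le> exp (real i) * E" using assms(4) by simp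
  moreover have "0 < exp (real i) * E" using assms(2,3) by simp
  ultimately have "\<bar>r\<bar> / (exp (real i) * E) \<le> 1 / 3" by (simp add: pos_divide_le_eq)
  moreover have "\<bar>inverse c * r\<bar> = \<bar>r\<bar> / c" if "0 < c" for c
    using that by (simp add: abs_mult divide_inverse mult.commute)
  then have "\<bar>learning_rate E i * r\<bar> = \<bar>r\<bar> / (exp (real i) * E)"
    using \<open>0 < exp (real i) * E\<close> by (simp only: learning_rate_def)
  ultimately show ?thesis by simp
qed

text \<open>
  The grid is geometric with ratio \<open>exp 1\<close> and extends from about \<open>1 / (E * E * T)\<close> to about
  \<open>1 / E\<close>.
\<close>

lemma ex_learning_rate_approx:
  assumes "0 < E" "0 < \<eta>" "1 \<le> T" "E * \<eta> \<le> exp (- 1)" "exp 1 \<le> E * E * real T * \<eta>"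
  obtains i where "i \<in> rate_indices E T" "learning_rate E i \<le> \<eta>" "\<eta> \<le> exp 1 * learning_rate E i"
proof -
  define L where "L = - ln (E * \<eta>)"
  have "ln (E * \<eta>) \<le> ln (exp (- 1))" using assms by (subst ln_le_cancel_iff) auto
  then have L1: "1 \<le> L" by (simp add: L_def)
  have expL: "exp (- L) = E * \<eta>" using assms by (simp add: L_def)
  have "ln (exp 1) \<le> ln ((E * real T) * (E * \<eta>))"
    using assms by (subst ln_le_cancel_iff) (auto simp: mult_ac)
  then have L2: "L + 1 \<le> ln (E * real T)" using assms by (subst (asm) ln_mult) (auto simp: L_def)
  define i where "i = nat \<lceil>L\<rceil>"
  have i: "L \<le> real i" "real i \<le> L + 1" using L1 by (auto simp: i_def)
  have "i \<in> rate_indices E T" using i L1 L2 by (auto simp: rate_indices_def)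
  moreover have "learning_rate E i \<le> \<eta>"
  proof -
    have "learning_rate E i = exp (- real i) / E" by (simp add: learning_rate_def exp_minus field_simps)
    also have "\<dots> \<le> exp (- L) / E" using i assms by (intro divide_right_mono) auto
    finally show ?thesis using assms expL by simp
  qed
  moreover have "\<eta> \<le> exp 1 * learning_rate E i"
  proof -
    have "\<eta> = exp (- L) / E" using assms expL by simp
    also have "\<dots> \<le> exp (1 - real i) / E" using i assms by (intro divide_right_mono) auto
    also have "\<dots> = exp 1 * learning_rate E i"
      by (simp add: learning_rate_def exp_diff field_simps)
    finally show ?thesis .
  qed
  ultimately show thesis by (rule that)
qed

definition squint_regret ::
  "(real ^ 'd) set \<Rightarrow> real \<Rightarrow> nat \<Rightarrow> (real ^ 'd \<Rightarrow> real) \<Rightarrow> (nat \<Rightarrow> real ^ 'd \<Rightarrow> real ^ 'd) \<Rightarrow>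
    nat \<Rightarrow> real ^ 'd \<Rightarrow> real" where
  "squint_regret \<Theta> E T \<pi>0 gr s v =
     gr s (squint_prediction \<Theta> E T \<pi>0 gr (s - 1)) \<bullet> (squint_prediction \<Theta> E T \<pi>0 gr (s - 1) - v)"

lemma squint_prediction_eq:
  "squint_prediction \<Theta> E T \<pi>0 gr t =
     (\<Sum>\<theta>\<in>\<Theta>. squint_weight \<Theta> E T \<pi>0 (squint_regret \<Theta> E T \<pi>0 gr) t \<theta> *\<^sub>R \<theta>)"
  by (subst squint_prediction.simps) (simp add: squint_regret_def[abs_def])

lemma squint_potential_pos:
  assumes "0 < E" "rate_indices E T \<noteq> {}"
  shows "0 < squint_potential E T r t \<theta>"
  unfolding squint_potential_def using assms finite_rate_indices
  by (intro sum_pos) (auto simp: learning_rate_pos)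

context
  fixes \<Theta> :: "'v set" and E :: real and T :: nat
  assumes \<Theta>: "finite \<Theta>" "\<Theta> \<noteq> {}" and E: "0 < E" and rates: "rate_indices E T \<noteq> {}"
begin

lemma squint_mass_pos:
  "0 < (\<Sum>\<theta>\<in>\<Theta>. squint_potential E T r t \<theta> * uniform_weight \<Theta> \<theta>)"
  using \<Theta> by (intro sum_pos) (auto simp: uniform_weight_def card_gt_0_iff squint_potential_pos[OF E rates])

lemma squint_weight_nonneg:
  assumes "\<theta> \<in> \<Theta>"
  shows "0 \<le> squint_weight \<Theta> E T (uniform_weight \<Theta>) r t \<theta>"
proof (cases "t = 0")
  case False
  then show ?thesis unfolding squint_weight_def
    using squint_mass_pos[of r t] squint_potential_pos[OF E rates, of r t \<theta>]
    by (auto intro!: divide_nonneg_nonneg mult_nonneg_nonneg simp: uniform_weight_def)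
qed (simp add: squint_weight_def uniform_weight_def)

lemma sum_squint_weight: "(\<Sum>\<theta>\<in>\<Theta>. squint_weight \<Theta> E T (uniform_weight \<Theta>) r t \<theta>) = 1"
proof (cases "t = 0")
  case True
  then show ?thesis using \<Theta> by (simp add: squint_weight_def uniform_weight_def)
next
  case False
  then show ?thesis
    using squint_mass_pos[of r t] by (simp add: squint_weight_def sum_divide_distrib[symmetric])
qed

text \<open>
  Apart from the factor normalising them, the weights are the potentials, also before the first
  observation: then all potentials are equal.
\<close>

lemma sum_squint_potential_eq_0:
  assumes "(\<Sum>\<theta>\<in>\<Theta>. squint_weight \<Theta> E T (uniform_weight \<Theta>) r t \<theta> * f \<theta>) = 0"
  shows "(\<Sum>\<theta>\<in>\<Theta>. squint_potential E T r t \<theta> * f \<theta>) = 0"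
proof (cases "t = 0")
  case True
  have "(\<Sum>\<theta>\<in>\<Theta>. squint_potential E T r t \<theta> * f \<theta>)
      = (\<Sum>i\<in>rate_indices E T. learning_rate E i) * (\<Sum>\<theta>\<in>\<Theta>. f \<theta>)"
    using True by (simp add: squint_potential_def sum_distrib_left)
  moreover have "(\<Sum>\<theta>\<in>\<Theta>. f \<theta>) = 0"
    using assms True \<Theta> by (simp add: squint_weight_def uniform_weight_def sum_divide_distrib[symmetric])
  ultimately show ?thesis by simp
next
  case False
  let ?S = "\<Sum>\<theta>'\<in>\<Theta>. squint_potential E T r t \<theta>' * uniform_weight \<Theta> \<theta>'"
  have "(\<Sum>\<theta>\<in>\<Theta>. squint_weight \<Theta> E T (uniform_weight \<Theta>) r t \<theta> * f \<theta>)
      = (\<Sum>\<theta>\<in>\<Theta>. squint_potential E T r t \<theta> * f \<theta>) / (real (card \<Theta>) * ?S)"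
    using False by (simp add: squint_weight_def uniform_weight_def sum_divide_distrib mult_ac)
  then show ?thesis
    using assms squint_mass_pos[of r t] \<Theta> by simp
qed

text \<open>
  The mixture does not increase: \<open>exp_minus_square_le\<close> bounds its growth in round \<open>n + 1\<close> by the
  regrets of that round weighted with the potentials, and this sum vanishes.
\<close>

lemma squint_mixture_bound:
  assumes balanced: "\<And>t. t < n \<Longrightarrow>
      (\<Sum>\<theta>\<in>\<Theta>. squint_weight \<Theta> E T (uniform_weight \<Theta>) r t \<theta> * r (Suc t) \<theta>) = 0"
    and small: "\<And>t i \<theta>. t < n \<Longrightarrow> i \<in> rate_indices E T \<Longrightarrow> \<theta> \<in> \<Theta> \<Longrightarrow>
      \<bar>learning_rate E i * r (Suc t) \<theta>\<bar> \<le> 1 / 3"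
  shows "(\<Sum>\<theta>\<in>\<Theta>. \<Sum>i\<in>rate_indices E T.
      exp (learning_rate E i * (\<Sum>s\<in>{1..n}. r s \<theta> - learning_rate E i * (r s \<theta>)\<^sup>2)))
    \<le> real (card \<Theta>) * real (card (rate_indices E T))"
  using assms
proof (induction n)
  case 0
  show ?case by simp
next
  case (Suc n)
  let ?\<eta> = "learning_rate E"
  let ?e = "\<lambda>i \<theta>. exp (?\<eta> i * (\<Sum>s\<in>{1..n}. r s \<theta> - ?\<eta> i * (r s \<theta>)\<^sup>2))"
  have step: "exp (?\<eta> i * (\<Sum>s\<in>{1..Suc n}. r s \<theta> - ?\<eta> i * (r s \<theta>)\<^sup>2))
      \<le> ?e i \<theta> + ?\<eta> i * ?e i \<theta> * r (Suc n) \<theta>"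
    if "i \<in> rate_indices E T" "\<theta> \<in> \<Theta>" for i \<theta>
  proof -
    let ?x = "?\<eta> i * r (Suc n) \<theta>"
    have "exp (?\<eta> i * (\<Sum>s\<in>{1..Suc n}. r s \<theta> - ?\<eta> i * (r s \<theta>)\<^sup>2)) = ?e i \<theta> * exp (?x - ?x\<^sup>2)"
      by (simp add: exp_add[symmetric] algebra_simps power2_eq_square)
    also have "\<dots> \<le> ?e i \<theta> * (1 + ?x)"
      using Suc.prems(2)[of n i \<theta>] that by (intro mult_left_mono exp_minus_square_le) auto
    finally show ?thesis by (simp add: algebra_simps)
  qed
  have "(\<Sum>\<theta>\<in>\<Theta>. \<Sum>i\<in>rate_indices E T.
      exp (?\<eta> i * (\<Sum>s\<in>{1..Suc n}. r s \<theta> - ?\<eta> i * (r s \<theta>)\<^sup>2)))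
    \<le> (\<Sum>\<theta>\<in>\<Theta>. \<Sum>i\<in>rate_indices E T. ?e i \<theta> + ?\<eta> i * ?e i \<theta> * r (Suc n) \<theta>)"
    by (intro sum_mono step)
  also have "\<dots> = (\<Sum>\<theta>\<in>\<Theta>. \<Sum>i\<in>rate_indices E T. ?e i \<theta>)
      + (\<Sum>\<theta>\<in>\<Theta>. squint_potential E T r n \<theta> * r (Suc n) \<theta>)"
    by (simp add: sum.distrib squint_potential_def sum_distrib_right)
  also have "(\<Sum>\<theta>\<in>\<Theta>. squint_potential E T r n \<theta> * r (Suc n) \<theta>) = 0"
    using Suc.prems(1)[of n] by (intro sum_squint_potential_eq_0) simp
  also have "(\<Sum>\<theta>\<in>\<Theta>. \<Sum>i\<in>rate_indices E T. ?e i \<theta>) + 0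
      \<le> real (card \<Theta>) * real (card (rate_indices E T))"
    using Suc.IH Suc.prems by simp
  finally show ?case .
qed

end

lemma squint_prediction_in_convex_hull:
  fixes \<Theta> :: "(real ^ 'd) set"
  assumes "finite \<Theta>" "\<Theta> \<noteq> {}" "0 < E" "rate_indices E T \<noteq> {}"
  shows "squint_prediction \<Theta> E T (uniform_weight \<Theta>) gr t \<in> convex hull \<Theta>"
  unfolding squint_prediction_eq
  by (rule convex_sum[OF assms(1) convex_convex_hull])
     (auto simp: sum_squint_weight[OF assms] squint_weight_nonneg[OF assms] hull_inc)

text \<open>
  The prediction is the mean of the grid under the current weights, so the mean regret is zero
  whatever gradient is revealed.
\<close>

lemma squint_regret_balanced:
  fixes \<Theta> :: "(real ^ 'd) set" and gr :: "nat \<Rightarrow> real ^ 'd \<Rightarrow> real ^ 'd"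
  assumes "finite \<Theta>" "\<Theta> \<noteq> {}" "0 < E" "rate_indices E T \<noteq> {}"
  defines "r \<equiv> squint_regret \<Theta> E T (uniform_weight \<Theta>) gr"
  shows "(\<Sum>\<theta>\<in>\<Theta>. squint_weight \<Theta> E T (uniform_weight \<Theta>) r t \<theta> * r (Suc t) \<theta>) = 0"
proof -
  let ?w = "squint_weight \<Theta> E T (uniform_weight \<Theta>) r t"
  let ?P = "squint_prediction \<Theta> E T (uniform_weight \<Theta>) gr t"
  have "(\<Sum>\<theta>\<in>\<Theta>. ?w \<theta> * r (Suc t) \<theta>) = gr (Suc t) ?P \<bullet> (\<Sum>\<theta>\<in>\<Theta>. ?w \<theta> *\<^sub>R (?P - \<theta>))"
    by (simp add: r_def squint_regret_def inner_sum_right)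
  also have "(\<Sum>\<theta>\<in>\<Theta>. ?w \<theta> *\<^sub>R (?P - \<theta>)) = (\<Sum>\<theta>\<in>\<Theta>. ?w \<theta>) *\<^sub>R ?P - (\<Sum>\<theta>\<in>\<Theta>. ?w \<theta> *\<^sub>R \<theta>)"
    by (simp add: scaleR_diff_right sum_subtractf scaleR_sum_left)
  also have "\<dots> = 0"
    using squint_prediction_eq[of \<Theta> E T "uniform_weight \<Theta>" gr t] sum_squint_weight[OF assms(1-4), of r t]
    by (simp add: r_def)
  finally show ?thesis by simp
qed

text \<open>
  Each summand of the mixture is at most the mixture.
\<close>

lemma squint_regret_bound:
  fixes \<Theta> :: "(real ^ 'd) set" and gr :: "nat \<Rightarrow> real ^ 'd \<Rightarrow> real ^ 'd"
  assumes "finite \<Theta>" "\<theta> \<in> \<Theta>" "i \<in> rate_indices E T" "E = 8 * G / 3" "0 < G"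
  defines "r \<equiv> squint_regret \<Theta> E T (uniform_weight \<Theta>) gr"
  assumes "\<And>t \<theta>. t \<in> {1..T} \<Longrightarrow> \<theta> \<in> \<Theta> \<Longrightarrow> \<bar>r t \<theta>\<bar> \<le> 2 * G"
  shows "learning_rate E i * (\<Sum>s\<in>{1..T}. r s \<theta>) - (learning_rate E i)\<^sup>2 * (\<Sum>s\<in>{1..T}. (r s \<theta>)\<^sup>2)
    \<le> ln (real (card \<Theta>) * real (card (rate_indices E T)))"
proof -
  let ?e = "\<lambda>\<theta> i. exp (learning_rate E i * (\<Sum>s\<in>{1..T}. r s \<theta> - learning_rate E i * (r s \<theta>)\<^sup>2))"
  have ne: "\<Theta> \<noteq> {}" "0 < E" "rate_indices E T \<noteq> {}"
    using assms(2,3) by (auto simp only: empty_iff) (simp add: assms(4,5))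
  have "?e \<theta> i \<le> (\<Sum>i\<in>rate_indices E T. ?e \<theta> i)"
    by (rule member_le_sum[OF assms(3)]) (auto simp: finite_rate_indices)
  also have "\<dots> \<le> (\<Sum>\<theta>\<in>\<Theta>. \<Sum>i\<in>rate_indices E T. ?e \<theta> i)"
    using assms(1) by (intro member_le_sum[OF assms(2), of "\<lambda>\<theta>. \<Sum>i\<in>rate_indices E T. ?e \<theta> i"] sum_nonneg) auto
  also have "\<dots> \<le> real (card \<Theta>) * real (card (rate_indices E T))"
  proof (rule squint_mixture_bound[OF assms(1) ne])
    show "(\<Sum>\<theta>\<in>\<Theta>. squint_weight \<Theta> E T (uniform_weight \<Theta>) r t \<theta> * r (Suc t) \<theta>) = 0" for t
      unfolding r_def by (rule squint_regret_balanced[OF assms(1) ne])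
    show "\<bar>learning_rate E i * r (Suc t) \<theta>\<bar> \<le> 1 / 3"
      if "t < T" "i \<in> rate_indices E T" "\<theta> \<in> \<Theta>" for t i \<theta>
      using that by (intro abs_learning_rate_mult_le[OF _ assms(4,5)] assms(7)) auto
  qed
  finally have "ln (?e \<theta> i) \<le> ln (real (card \<Theta>) * real (card (rate_indices E T)))"
    by (subst ln_le_cancel_iff) (auto intro: less_le_trans[OF exp_gt_zero])
  moreover have "(\<Sum>s\<in>{1..T}. r s \<theta> - learning_rate E i * (r s \<theta>)\<^sup>2)
      = (\<Sum>s\<in>{1..T}. r s \<theta>) - learning_rate E i * (\<Sum>s\<in>{1..T}. (r s \<theta>)\<^sup>2)"
    by (simp only: sum_subtractf sum_distrib_left)
  ultimately show ?thesis by (simp only: ln_exp right_diff_distrib power2_eq_square mult.assoc)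
qed

section \<open>Deviations of conditional means\<close>

lemma (in sigma_finite_subalgebra) nn_cond_exp_eq_real_cond_exp:
  assumes f: "integrable M f" and pos: "AE x in M. 0 \<le> f x"
  shows "AE x in M. nn_cond_exp M F (\<lambda>x. ennreal (f x)) x = ennreal (real_cond_exp M F f x)"
proof -
  have [measurable]: "f \<in> borel_measurable M" using f by simp
  have "(\<integral>\<^sup>+ x. nn_cond_exp M F (\<lambda>x. ennreal (f x)) x \<partial>M) = (\<integral>\<^sup>+ x. ennreal (f x) \<partial>M)"
    using nn_cond_exp_intg[of "\<lambda>_. 1" "\<lambda>x. ennreal (f x)"] by simp
  also have "\<dots> < \<infinity>" using integrableD(2)[OF f] by (simp add: less_top)
  finally have fin: "AE x in M. nn_cond_exp M F (\<lambda>x. ennreal (f x)) x \<noteq> \<infinity>"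
    by (intro nn_integral_PInf_AE) (auto simp: measurable_from_subalg[OF subalg])
  have "AE x in M. nn_cond_exp M F (\<lambda>x. ennreal (- f x)) x = nn_cond_exp M F (\<lambda>_. 0) x"
    using pos by (intro nn_cond_exp_cong) (auto simp: ennreal_neg elim!: eventually_mono)
  moreover have "AE x in M. 0 = nn_cond_exp M F (\<lambda>_. 0) x" by (rule nn_cond_exp_F_meas) simp
  ultimately show ?thesis using fin
  proof eventually_elim
    case (elim x)
    then show ?case by (simp add: real_cond_exp_def less_top)
  qed
qed

lemma (in finite_measure) AE_bounded_integrable:
  fixes f :: "'a \<Rightarrow> real"
  assumes "f \<in> borel_measurable M" "AE x in M. \<bar>f x\<bar> \<le> B"
  shows "integrable M f"
  by (rule integrable_const_bound[where B = B]) (use assms in auto)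

lemma exp_le_quadratic:
  fixes y :: real
  assumes "y \<le> 1"
  shows "exp y \<le> 1 + y + y\<^sup>2"
proof (cases "0 \<le> y")
  case True
  then show ?thesis using assms exp_bound[of y] by simp
next
  case False
  define z where "z = - y"
  have z: "0 \<le> z" using False by (simp add: z_def)
  have "1 \<le> (1 - z + z\<^sup>2) * (1 + z + z\<^sup>2 / 2)"
  proof -
    have "(1 - z + z\<^sup>2) * (1 + z + z\<^sup>2 / 2) = 1 + z ^ 2 / 2 + z ^ 3 / 2 + z ^ 4 / 2"
      by (simp add: field_simps power2_eq_square power3_eq_cube power4_eq_xxxx)
    then show ?thesis using z by simp
  qed
  also have "\<dots> \<le> (1 - z + z\<^sup>2) * exp z"
  proof (rule mult_left_mono[OF exp_lower_Taylor_quadratic[OF z]])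
    have "0 \<le> (1 - z / 2)\<^sup>2 + 3 / 4 * z\<^sup>2" by simp
    then show "0 \<le> 1 - z + z\<^sup>2" by (simp add: power2_eq_square algebra_simps)
  qed
  finally have "1 / exp z \<le> 1 - z + z\<^sup>2" by (simp add: pos_divide_le_eq)
  then show ?thesis by (simp add: z_def exp_minus inverse_eq_divide)
qed

text \<open>
  The constant 3 comes from \<open>1 + (1 - u)\<^sup>2 \<le> 1 + (4 / 3)\<^sup>2 < 3\<close>.
\<close>

lemma exp_square_minus_le:
  fixes u :: real
  assumes "\<bar>u\<bar> \<le> 1 / 3"
  shows "exp (u\<^sup>2 - u) \<le> 1 - u + 3 * u\<^sup>2"
proof -
  have u2: "u\<^sup>2 \<le> (1 / 3)\<^sup>2" using power_mono[OF assms abs_ge_zero, of 2] by simp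
  then have "exp (u\<^sup>2 - u) \<le> 1 + (u\<^sup>2 - u) + (u\<^sup>2 - u)\<^sup>2"
    using assms by (intro exp_le_quadratic) (simp add: power2_eq_square)
  also have "(u\<^sup>2 - u)\<^sup>2 = u\<^sup>2 * (1 - u)\<^sup>2" by (simp add: power2_eq_square algebra_simps)
  also have "\<dots> \<le> u\<^sup>2 * (4 / 3)\<^sup>2" using assms by (intro mult_left_mono power_mono) auto
  also have "1 + (u\<^sup>2 - u) + u\<^sup>2 * (4 / 3)\<^sup>2 \<le> 1 - u + 3 * u\<^sup>2"
    using zero_le_power2[of u] by (simp add: power2_eq_square)
  finally show ?thesis by simp
qed

text \<open>
  Conditionally, \<open>exp (U\<^sup>2 - U)\<close> has mean at most \<open>1 - \<E> U + 3 * \<E> U\<^sup>2\<close>, which is at most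
  \<open>exp (3 * \<E> U\<^sup>2 - \<E> U)\<close>.  The square \<open>U\<^sup>2\<close> is kept in the exponent so that the deviation bound can
  be added to the regret bound of Squint, which contains it with the opposite sign.
\<close>

lemma (in finite_measure_subalgebra) nn_cond_exp_exponential_le_1:
  assumes U[measurable]: "U \<in> borel_measurable M" and bnd: "AE x in M. \<bar>U x\<bar> \<le> 1 / 3"
  shows "AE x in M. nn_cond_exp M F (\<lambda>x. ennreal (exp (real_cond_exp M F U x - U x + (U x)\<^sup>2
      - 3 * real_cond_exp M F (\<lambda>x. (U x)\<^sup>2) x))) x \<le> 1"
proof -
  let ?m = "real_cond_exp M F U" and ?v = "real_cond_exp M F (\<lambda>x. (U x)\<^sup>2)"
  define h where "h x = 1 - U x + 3 * (U x)\<^sup>2" for x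
  have intU: "integrable M U" using bnd by (rule AE_bounded_integrable[OF U])
  have intU2: "integrable M (\<lambda>x. (U x)\<^sup>2)"
  proof (rule AE_bounded_integrable)
    show "AE x in M. \<bar>(U x)\<^sup>2\<bar> \<le> (1 / 3)\<^sup>2" using bnd
      by eventually_elim (metis abs_ge_zero abs_power2 power2_abs power_mono)
  qed simp
  have inth: "integrable M h" unfolding h_def using intU intU2 by auto
  have h: "AE x in M. exp ((U x)\<^sup>2 - U x) \<le> h x"
    using bnd by eventually_elim (simp add: h_def exp_square_minus_le)
  have eh: "AE x in M. real_cond_exp M F h x = 1 - ?m x + 3 * ?v x"
  proof -
    have "AE x in M. real_cond_exp M F h x
        = real_cond_exp M F (\<lambda>x. 1 - U x) x + real_cond_exp M F (\<lambda>x. 3 * (U x)\<^sup>2) x"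
      unfolding h_def using intU intU2 by (intro real_cond_exp_add) auto
    moreover have "AE x in M. real_cond_exp M F (\<lambda>x. 1 - U x) x = real_cond_exp M F (\<lambda>_. 1) x - ?m x"
      using intU by (intro real_cond_exp_diff) auto
    moreover have "AE x in M. real_cond_exp M F (\<lambda>_. 1) x = 1" by (intro real_cond_exp_F_meas) auto
    moreover have "AE x in M. real_cond_exp M F (\<lambda>x. 3 * (U x)\<^sup>2) x = 3 * ?v x"
      using intU2 by (intro real_cond_exp_cmult) auto
    ultimately show ?thesis by eventually_elim simp
  qed
  have "AE x in M. nn_cond_exp M F (\<lambda>x. ennreal (exp ((U x)\<^sup>2 - U x))) x
      \<le> nn_cond_exp M F (\<lambda>x. ennreal (h x)) x"
    using h inth by (intro nn_cond_exp_mono) (auto simp: ennreal_leI elim!: eventually_mono)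
  moreover have "AE x in M. nn_cond_exp M F (\<lambda>x. ennreal (h x)) x = ennreal (real_cond_exp M F h x)"
  proof (rule nn_cond_exp_eq_real_cond_exp[OF inth])
    show "AE x in M. 0 \<le> h x" using h by eventually_elim (meson exp_ge_zero order_trans)
  qed
  moreover have "AE x in M. ennreal (exp (?m x - 3 * ?v x)) * nn_cond_exp M F (\<lambda>x. ennreal (exp ((U x)\<^sup>2 - U x))) x
      = nn_cond_exp M F (\<lambda>x. ennreal (exp (?m x - 3 * ?v x)) * ennreal (exp ((U x)\<^sup>2 - U x))) x"
    by (rule nn_cond_exp_prod) auto
  ultimately show ?thesis using eh
  proof eventually_elim
    case (elim x)
    have "nn_cond_exp M F (\<lambda>x. ennreal (exp (?m x - U x + (U x)\<^sup>2 - 3 * ?v x))) x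
        = ennreal (exp (?m x - 3 * ?v x)) * nn_cond_exp M F (\<lambda>x. ennreal (exp ((U x)\<^sup>2 - U x))) x"
      unfolding elim(3) by (simp add: ennreal_mult[symmetric] exp_add[symmetric] algebra_simps)
    also have "\<dots> \<le> ennreal (exp (?m x - 3 * ?v x)) * ennreal (1 - ?m x + 3 * ?v x)"
      using elim by (intro mult_left_mono) auto
    also have "\<dots> \<le> ennreal (exp (?m x - 3 * ?v x)) * ennreal (exp (- (?m x - 3 * ?v x)))"
      using exp_ge_add_one_self[of "- (?m x - 3 * ?v x)"]
      by (intro mult_left_mono ennreal_leI) (auto simp del: exp_ge_add_one_self)
    also have "\<dots> = 1" by (simp add: ennreal_mult[symmetric] exp_add[symmetric])
    finally show ?case .
  qed
qed

text \<open>
  A product of nonnegative factors with conditional means at most 1 is a supermartingale.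
\<close>

lemma nn_integral_prod_le_1:
  fixes Z :: "nat \<Rightarrow> 'w \<Rightarrow> ennreal"
  assumes "prob_space M"
    and sub: "\<And>s. s \<le> n \<Longrightarrow> sigma_finite_subalgebra M (F s)"
    and mono: "\<And>s t. s \<le> t \<Longrightarrow> t \<le> n \<Longrightarrow> subalgebra (F t) (F s)"
    and Z: "\<And>s. s \<in> {1..n} \<Longrightarrow> Z s \<in> borel_measurable (F s)"
    and le: "\<And>s. s \<in> {1..n} \<Longrightarrow> AE \<omega> in M. nn_cond_exp M (F (s - 1)) (Z s) \<omega> \<le> 1"
  shows "(\<integral>\<^sup>+ \<omega>. (\<Prod>s\<in>{1..n}. Z s \<omega>) \<partial>M) \<le> 1"
  using assms(2-)
proof (induction n)
  case 0
  then show ?case using prob_space.emeasure_space_1[OF assms(1)] by simp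
next
  case (Suc n)
  interpret sigma_finite_subalgebra M "F n" using Suc.prems(1) by simp
  let ?P = "\<lambda>\<omega>. \<Prod>s\<in>{1..n}. Z s \<omega>"
  have P: "?P \<in> borel_measurable (F n)"
  proof (rule borel_measurable_prod_ennreal)
    show "Z s \<in> borel_measurable (F n)" if "s \<in> {1..n}" for s
      using that by (intro measurable_from_subalg[OF Suc.prems(2)[of s n] Suc.prems(3)]) auto
  qed
  have Zn: "Z (Suc n) \<in> borel_measurable M"
    using Suc.prems(1,3)[of "Suc n"] by (auto intro: measurable_from_subalg sigma_finite_subalgebra.subalg)
  have "(\<integral>\<^sup>+ \<omega>. (\<Prod>s\<in>{1..Suc n}. Z s \<omega>) \<partial>M) = (\<integral>\<^sup>+ \<omega>. ?P \<omega> * Z (Suc n) \<omega> \<partial>M)"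
    by (simp add: mult.commute)
  also have "\<dots> = (\<integral>\<^sup>+ \<omega>. ?P \<omega> * nn_cond_exp M (F n) (Z (Suc n)) \<omega> \<partial>M)"
    by (rule nn_cond_exp_intg[OF P Zn, symmetric])
  also have "\<dots> \<le> (\<integral>\<^sup>+ \<omega>. ?P \<omega> \<partial>M)"
    using Suc.prems(4)[of "Suc n"]
    by (intro nn_integral_mono_AE) (auto intro: mult_left_le elim!: eventually_mono)
  also have "\<dots> \<le> 1" using Suc.prems by (intro Suc.IH) auto
  finally show ?case .
qed

text \<open>
  Markov's inequality is applied once, to the sum of the variables.
\<close>

lemma uniform_markov_event:
  fixes W :: "'j \<Rightarrow> 'w \<Rightarrow> ennreal"
  assumes "prob_space M" and J: "finite J" "J \<noteq> {}"
    and W[measurable]: "\<And>j. j \<in> J \<Longrightarrow> W j \<in> borel_measurable M"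
    and le: "\<And>j. j \<in> J \<Longrightarrow> (\<integral>\<^sup>+ \<omega>. W j \<omega> \<partial>M) \<le> 1"
  obtains A where "A \<in> sets M" "1 - exp (- x) \<le> measure M A"
    "\<And>\<omega> j. \<omega> \<in> A \<Longrightarrow> j \<in> J \<Longrightarrow> W j \<omega> < ennreal (real (card J) * exp x)"
proof -
  interpret prob_space M by fact
  let ?S = "\<lambda>\<omega>. \<Sum>j\<in>J. W j \<omega>"
  let ?c = "real (card J) * exp x"
  have c: "0 < ?c" using J by (auto simp: card_gt_0_iff)
  define B where "B = {\<omega> \<in> space M. 1 \<le> ennreal (1 / ?c) * ?S \<omega>}"
  have S[measurable]: "?S \<in> borel_measurable M" by simp
  have B: "B \<in> sets M" unfolding B_def by measurable
  have "emeasure M B \<le> ennreal (1 / ?c) * (\<integral>\<^sup>+ \<omega>. ?S \<omega> \<partial>M)"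
    using nn_integral_Markov_inequality[of ?S "space M" M "ennreal (1 / ?c)"]
    by (simp add: B_def cong: nn_integral_cong)
  also have "(\<integral>\<^sup>+ \<omega>. ?S \<omega> \<partial>M) = (\<Sum>j\<in>J. \<integral>\<^sup>+ \<omega>. W j \<omega> \<partial>M)"
    by (rule nn_integral_sum) simp
  also have "\<dots> \<le> (\<Sum>j\<in>J. 1)" by (intro sum_mono le)
  also have "ennreal (1 / ?c) * (\<Sum>j\<in>J. 1) = ennreal (exp (- x))"
    using c J by (simp add: ennreal_of_nat_eq_real_of_nat ennreal_mult[symmetric] exp_minus field_simps card_gt_0_iff)
  finally have "emeasure M B \<le> ennreal (exp (- x))" by (simp add: mult_left_mono)
  then have mB: "measure M B \<le> exp (- x)" by (simp add: emeasure_eq_measure)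
  show thesis
  proof (rule that[of "space M - B"])
    show "space M - B \<in> sets M" using B by simp
    show "1 - exp (- x) \<le> measure M (space M - B)" using mB B by (simp add: prob_compl)
    show "W j \<omega> < ennreal ?c" if "\<omega> \<in> space M - B" "j \<in> J" for \<omega> j
    proof -
      have "W j \<omega> \<le> ?S \<omega>" using that J by (intro member_le_sum) auto
      also have "?S \<omega> < ennreal ?c"
      proof (rule ccontr)
        assume "\<not> ?S \<omega> < ennreal ?c"
        then have "ennreal (1 / ?c) * ennreal ?c \<le> ennreal (1 / ?c) * ?S \<omega>" by (intro mult_left_mono) auto
        moreover have "ennreal (1 / ?c) * ennreal ?c = 1" using J by (auto simp: ennreal_mult[symmetric] card_gt_0_iff)
        ultimately show False using that by (simp add: B_def)
      qed
      finally show ?thesis .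
    qed
  qed
qed

text \<open>
  An inequality of Freedman type, simultaneous for finitely many adapted processes.
\<close>

lemma conditional_mean_deviation:
  fixes U :: "'j \<Rightarrow> nat \<Rightarrow> 'w \<Rightarrow> real"
  assumes "prob_space M" and J: "finite J" "J \<noteq> {}"
    and sub: "\<And>s. s \<le> n \<Longrightarrow> subalgebra M (F s)"
    and mono: "\<And>s t. s \<le> t \<Longrightarrow> t \<le> n \<Longrightarrow> subalgebra (F t) (F s)"
    and U: "\<And>j s. j \<in> J \<Longrightarrow> s \<in> {1..n} \<Longrightarrow> U j s \<in> borel_measurable (F s)"
    and bnd: "\<And>j s. j \<in> J \<Longrightarrow> s \<in> {1..n} \<Longrightarrow> AE \<omega> in M. \<bar>U j s \<omega>\<bar> \<le> 1 / 3"
  obtains A where "A \<in> sets M" "1 - exp (- x) \<le> measure M A"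
    "\<And>\<omega> j. \<omega> \<in> A \<Longrightarrow> j \<in> J \<Longrightarrow>
       (\<Sum>s\<in>{1..n}. real_cond_exp M (F (s - 1)) (U j s) \<omega> - U j s \<omega> + (U j s \<omega>)\<^sup>2
          - 3 * real_cond_exp M (F (s - 1)) (\<lambda>\<omega>. (U j s \<omega>)\<^sup>2) \<omega>) \<le> ln (real (card J)) + x"
proof -
  interpret prob_space M by fact
  have fms: "finite_measure_subalgebra M (F s)" if "s \<le> n" for s
    by (simp add: finite_measure_subalgebra_def finite_measure_subalgebra_axioms_def finite_measure_axioms sub that)
  define V where "V j s \<omega> = real_cond_exp M (F (s - 1)) (U j s) \<omega> - U j s \<omega> + (U j s \<omega>)\<^sup>2
          - 3 * real_cond_exp M (F (s - 1)) (\<lambda>\<omega>. (U j s \<omega>)\<^sup>2) \<omega>" for j s \<omega>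
  have V: "V j s \<in> borel_measurable (F s)" if "j \<in> J" "s \<in> {1..n}" for j s
  proof -
    have [measurable]: "U j s \<in> borel_measurable (F s)" by (rule U[OF that])
    have [measurable]: "real_cond_exp M (F (s - 1)) f \<in> borel_measurable (F s)" for f
      using that by (intro measurable_from_subalg[OF mono[of "s - 1" s]]) auto
    show ?thesis unfolding V_def by measurable
  qed
  have VM: "V j s \<in> borel_measurable M" if "j \<in> J" "s \<in> {1..n}" for j s
    using that by (intro measurable_from_subalg[OF sub V]) auto
  have exp_eq: "(\<Prod>s\<in>{1..n}. ennreal (exp (V j s \<omega>))) = ennreal (exp (\<Sum>s\<in>{1..n}. V j s \<omega>))" for j \<omega>
    by (simp add: prod_ennreal exp_sum)
  obtain A where A: "A \<in> sets M" "1 - exp (- x) \<le> measure M A"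
    "\<And>\<omega> j. \<omega> \<in> A \<Longrightarrow> j \<in> J \<Longrightarrow> ennreal (exp (\<Sum>s\<in>{1..n}. V j s \<omega>)) < ennreal (real (card J) * exp x)"
  proof (rule uniform_markov_event[OF assms(1) J, of "\<lambda>j \<omega>. ennreal (exp (\<Sum>s\<in>{1..n}. V j s \<omega>))" x])
    show "(\<lambda>\<omega>. ennreal (exp (\<Sum>s\<in>{1..n}. V j s \<omega>))) \<in> borel_measurable M" if "j \<in> J" for j
      using VM[OF that] by simp
    show "(\<integral>\<^sup>+ \<omega>. ennreal (exp (\<Sum>s\<in>{1..n}. V j s \<omega>)) \<partial>M) \<le> 1" if j: "j \<in> J" for j
      unfolding exp_eq[symmetric]
    proof (rule nn_integral_prod_le_1[where F = F, OF assms(1)])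
      show "sigma_finite_subalgebra M (F s)" if "s \<le> n" for s
        by (rule finite_measure_subalgebra_is_sigma_finite[OF fms[OF that]])
      show "(\<lambda>\<omega>. ennreal (exp (V j s \<omega>))) \<in> borel_measurable (F s)" if "s \<in> {1..n}" for s
        using V[OF j that] by simp
      show "AE \<omega> in M. nn_cond_exp M (F (s - 1)) (\<lambda>\<omega>. ennreal (exp (V j s \<omega>))) \<omega> \<le> 1" if "s \<in> {1..n}" for s
        unfolding V_def using that U[OF j that]
        by (intro finite_measure_subalgebra.nn_cond_exp_exponential_le_1 fms bnd j measurable_from_subalg[OF sub]) auto
    qed (fact mono)
  qed blast
  show thesis
  proof (rule that[OF A(1,2)])
    fix \<omega> j assume "\<omega> \<in> A" "j \<in> J"
    then have "exp (\<Sum>s\<in>{1..n}. V j s \<omega>) \<le> real (card J) * exp x"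
      using A(3)[of \<omega> j] by (simp add: ennreal_less_iff)
    then have "ln (exp (\<Sum>s\<in>{1..n}. V j s \<omega>)) \<le> ln (real (card J) * exp x)"
      using J by (subst ln_le_cancel_iff) (auto simp: card_gt_0_iff)
    then show "(\<Sum>s\<in>{1..n}. real_cond_exp M (F (s - 1)) (U j s) \<omega> - U j s \<omega> + (U j s \<omega>)\<^sup>2
          - 3 * real_cond_exp M (F (s - 1)) (\<lambda>\<omega>. (U j s \<omega>)\<^sup>2) \<omega>) \<le> ln (real (card J)) + x"
      using J by (simp add: ln_mult V_def card_gt_0_iff)
  qed
qed

section \<open>Weak exp-concavity at random points\<close>

lemma inverse_power_0:
  assumes "0 \<le> y"
  shows "inverse_power 0 y = (if y < 1 then 0 else if y = 1 then 1 else \<infinity>)"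
proof -
  have lim: "inverse_power 0 y = l" if "((\<lambda>b. ennreal (y powr (1 / b))) \<longlongrightarrow> l) (at_right 0)" for l
    unfolding inverse_power_def using tendsto_Lim[OF trivial_limit_at_right_real that] by simp
  have inv: "filterlim (\<lambda>b. 1 / b :: real) at_top (at_right 0)"
    using filterlim_inverse_at_top_right by (simp add: inverse_eq_divide)
  consider "y = 0" | "0 < y" "y < 1" | "y = 1" | "1 < y" using assms by linarith
  then show ?thesis
  proof cases
    case 1
    then show ?thesis by (intro lim) simp
  next
    case 2
    have "filterlim (\<lambda>b. ln y * (1 / b)) at_bot (at_right 0)"
      using 2 by (intro filterlim_tendsto_neg_mult_at_bot[OF tendsto_const _ inv]) auto
    then have "((\<lambda>b. exp (ln y * (1 / b))) \<longlongrightarrow> 0) (at_right 0)"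
      by (rule filterlim_compose[OF exp_at_bot])
    then have "((\<lambda>b. ennreal (exp (ln y * (1 / b)))) \<longlongrightarrow> ennreal 0) (at_right 0)"
      by (rule tendsto_ennrealI)
    then show ?thesis using 2 lim[of 0] by (simp add: powr_def mult.commute)
  next
    case 3
    then show ?thesis by (intro lim) simp
  next
    case 4
    have "filterlim (\<lambda>b. ln y * (1 / b)) at_top (at_right 0)"
      using 4 by (intro filterlim_tendsto_pos_mult_at_top[OF tendsto_const _ inv]) auto
    then have "filterlim (\<lambda>b. exp (ln y * (1 / b))) at_top (at_right 0)"
      by (rule filterlim_compose[OF exp_at_top])
    then have "((\<lambda>b. ennreal (exp (ln y * (1 / b)))) \<longlongrightarrow> \<infinity>) (at_right 0)"
      by (simp add: ennreal_tendsto_top_eq_at_top)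
    then show ?thesis using 4 lim[of \<infinity>] by (simp add: powr_def mult.commute)
  qed
qed

text \<open>
  Young's inequality with exponents \<open>1 / \<beta>\<close> and \<open>1 / (1 - \<beta>)\<close>.  Parametrising it by the additive
  error \<open>c\<close> rather than by the factor of \<open>y\<close> covers \<open>\<beta> = 0\<close> and \<open>\<beta> = 1\<close> without division by zero.
  The proof compares \<open>c\<close> with \<open>y powr (1 / \<beta>)\<close>: the larger one bounds the weighted geometric mean of the two.
\<close>

lemma powr_mult_le_inverse_power:
  assumes "0 \<le> y" "0 < c" "0 \<le> \<beta>" "\<beta> \<le> 1"
  shows "ennreal (c powr (1 - \<beta>) * y) \<le> inverse_power \<beta> y + ennreal c"
proof (cases "\<beta> = 0")
  case True
  show ?thesis
  proof (cases "y \<le> 1")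
    case le: True
    then have "c * y \<le> c" using assms by (simp add: mult_left_le)
    then have "ennreal (c powr (1 - \<beta>) * y) \<le> ennreal c" using True assms by (simp add: ennreal_leI)
    then show ?thesis by (rule add_increasing[OF zero_le])
  qed (use True assms in \<open>simp add: inverse_power_0\<close>)
next
  case False
  then have \<beta>: "0 < \<beta>" using assms by simp
  define z where "z = y powr (1 / \<beta>)"
  have z: "0 \<le> z" "z powr \<beta> = y" using \<beta> assms by (auto simp: z_def powr_powr)
  have "c powr (1 - \<beta>) * y \<le> z + c"
  proof (cases "c \<le> z")
    case True
    then have "c powr (1 - \<beta>) * z powr \<beta> \<le> z powr (1 - \<beta>) * z powr \<beta>"
      using assms by (intro mult_right_mono powr_mono2) auto
    also have "\<dots> = z" using True assms by (simp add: powr_add[symmetric])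
    finally show ?thesis using z assms by simp
  next
    case False
    then have "c powr (1 - \<beta>) * z powr \<beta> \<le> c powr (1 - \<beta>) * c powr \<beta>"
      using assms z by (intro mult_left_mono powr_mono2) auto
    also have "\<dots> = c" using assms by (simp add: powr_add[symmetric])
    finally show ?thesis using z assms by simp
  qed
  then have "ennreal (c powr (1 - \<beta>) * y) \<le> ennreal (z + c)" by (rule ennreal_leI)
  then show ?thesis using False z assms by (simp add: inverse_power_def z_def)
qed

lemma measurable_inverse_power:
  assumes [measurable]: "Y \<in> borel_measurable M" and "\<And>\<omega>. 0 \<le> Y \<omega>"
  shows "(\<lambda>\<omega>. inverse_power \<beta> (Y \<omega>)) \<in> borel_measurable M"
proof (cases "\<beta> = 0")
  case True
  have "(\<lambda>\<omega>. inverse_power \<beta> (Y \<omega>)) = (\<lambda>\<omega>. if Y \<omega> < 1 then 0 else if Y \<omega> = 1 then 1 else \<infinity>)"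
    using True assms(2) by (simp add: inverse_power_0)
  also have "\<dots> \<in> borel_measurable M" by measurable
  finally show ?thesis .
next
  case False
  then show ?thesis by (simp add: inverse_power_def)
qed

text \<open>
  Points are rounded to a finite net: having finitely many values, a rounded prediction needs only
  finitely many almost sure statements about fixed points.
\<close>

lemma ex_measurable_finite_rounding:
  fixes S :: "'a :: euclidean_space set"
  assumes "compact S" "S \<noteq> {}" "0 < \<delta>"
  obtains N q where "finite N" "N \<subseteq> S" "q \<in> borel_measurable borel" "range q \<subseteq> N"
    "\<And>z. z \<in> S \<Longrightarrow> dist (q z) z < \<delta>"
proof -
  obtain z0 where z0: "z0 \<in> S" using assms by blast
  have "S \<subseteq> (\<Union>x\<in>S. ball x \<delta>)" using assms(3) by (auto intro: centre_in_ball[THEN iffD2])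
  then obtain N where N: "N \<subseteq> S" "finite N" "S \<subseteq> (\<Union>x\<in>N. ball x \<delta>)"
    by (rule compactE_image[OF assms(1), of S "\<lambda>x. ball x \<delta>", OF open_ball])
  have "\<exists>q. q \<in> borel_measurable borel \<and> range q \<subseteq> insert z0 N \<and> (\<forall>z\<in>(\<Union>x\<in>N. ball x \<delta>). dist (q z) z < \<delta>)"
    using N(2)
  proof (induction N)
    case empty
    show ?case by (intro exI[of _ "\<lambda>_. z0"]) auto
  next
    case (insert x N)
    then obtain q where q: "q \<in> borel_measurable borel" "range q \<subseteq> insert z0 N"
      "\<forall>z\<in>(\<Union>x\<in>N. ball x \<delta>). dist (q z) z < \<delta>" by blast
    have [measurable]: "q \<in> borel_measurable borel" by fact
    show ?case
    proof (intro exI[of _ "\<lambda>z. if dist x z < \<delta> then x else q z"] conjI)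
      show "(\<lambda>z. if dist x z < \<delta> then x else q z) \<in> borel_measurable borel" by measurable
      show "range (\<lambda>z. if dist x z < \<delta> then x else q z) \<subseteq> insert z0 (insert x N)"
        using q(2) by (auto simp: image_subset_iff)
      show "\<forall>z\<in>(\<Union>x\<in>insert x N. ball x \<delta>). dist (if dist x z < \<delta> then x else q z) z < \<delta>"
        using q(3) by (simp add: Ball_def)
    qed
  qed
  then obtain q where "q \<in> borel_measurable borel" "range q \<subseteq> insert z0 N"
    "\<forall>z\<in>(\<Union>x\<in>N. ball x \<delta>). dist (q z) z < \<delta>" by blast
  then show thesis
  proof (intro that[of "insert z0 N" q])
    show "dist (q z) z < \<delta>" if "z \<in> S" "\<forall>z\<in>(\<Union>x\<in>N. ball x \<delta>). dist (q z) z < \<delta>" for z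
      using that N(3) by blast
  qed (use N z0 in simp_all)
qed

lemma eq_sum_indicator:
  fixes h :: "'a \<Rightarrow> real"
  assumes "finite N" "w \<in> N"
  shows "h w = (\<Sum>z\<in>N. indicator {z} w * h z)"
proof -
  have "(\<Sum>z\<in>N. indicator {z} w * h z) = (\<Sum>z\<in>N. if w = z then h z else 0)"
    by (intro sum.cong) (auto simp: indicator_def)
  then show ?thesis using assms by simp
qed

text \<open>
  A function that is measurable in \<open>\<omega>\<close> and continuous in the point can be evaluated at random points:
  it is the limit of its values at rounded points.
\<close>

lemma borel_measurable_continuous_at_random_point:
  fixes f :: "'w \<Rightarrow> 'a :: euclidean_space \<Rightarrow> real"
  assumes f: "\<And>z. (\<lambda>\<omega>. f \<omega> z) \<in> borel_measurable M"
    and cont: "\<And>\<omega>. \<omega> \<in> space M \<Longrightarrow> continuous_on UNIV (f \<omega>)"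
    and P: "P \<in> borel_measurable M" "\<And>\<omega>. \<omega> \<in> space M \<Longrightarrow> P \<omega> \<in> S"
    and S: "compact S"
  shows "(\<lambda>\<omega>. f \<omega> (P \<omega>)) \<in> borel_measurable M"
proof (cases "S = {}")
  case True
  then have "space M = {}" using P(2) by auto
  then show ?thesis by (simp add: measurable_def)
next
  case False
  have "\<exists>N q. finite N \<and> N \<subseteq> S \<and> q \<in> borel_measurable borel \<and> range q \<subseteq> N \<and>
      (\<forall>z\<in>S. dist (q z) z < inverse (real (Suc n)))" for n
    using ex_measurable_finite_rounding[OF S False, of "inverse (real (Suc n))"] by (metis inverse_Suc)
  then obtain N q where Nq: "\<And>n. finite (N n)" "\<And>n. q n \<in> borel_measurable borel"
    "\<And>n. range (q n) \<subseteq> N n" "\<And>n z. z \<in> S \<Longrightarrow> dist (q n z) z < inverse (real (Suc n))" by metis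
  show ?thesis
  proof (rule borel_measurable_LIMSEQ_real[where u = "\<lambda>n \<omega>. f \<omega> (q n (P \<omega>))"])
    fix \<omega> assume \<omega>: "\<omega> \<in> space M"
    have "(\<lambda>n. q n (P \<omega>)) \<longlonglongrightarrow> P \<omega>"
    proof (rule metric_tendsto_imp_tendsto[OF LIMSEQ_inverse_real_of_nat])
      show "\<forall>\<^sub>F n in sequentially. dist (q n (P \<omega>)) (P \<omega>) \<le> dist (inverse (real (Suc n))) 0"
        using Nq(4)[OF P(2)[OF \<omega>]] by (intro always_eventually allI less_imp_le) simp
    qed
    moreover have "isCont (f \<omega>) (P \<omega>)"
      using cont[OF \<omega>] by (simp add: continuous_on_eq_continuous_at)
    ultimately show "(\<lambda>n. f \<omega> (q n (P \<omega>))) \<longlonglongrightarrow> f \<omega> (P \<omega>)"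
      using isCont_tendsto_compose by blast
  next
    fix n
    have [measurable]: "(\<lambda>\<omega>. q n (P \<omega>)) \<in> borel_measurable M"
      using measurable_compose[OF P(1) Nq(2)] by simp
    have "(\<lambda>\<omega>. f \<omega> (q n (P \<omega>))) = (\<lambda>\<omega>. \<Sum>z\<in>N n. indicator {z} (q n (P \<omega>)) * f \<omega> z)"
      using Nq(1) range_subsetD[OF Nq(3)] by (intro ext eq_sum_indicator)
    also have "\<dots> \<in> borel_measurable M" using f by measurable
    finally show "(\<lambda>\<omega>. f \<omega> (q n (P \<omega>))) \<in> borel_measurable M" .
  qed
qed

text \<open>
  The point \<open>W\<close> lies, up to an error \<open>\<epsilon>\<^sup>2\<close>, a fraction \<open>\<epsilon>\<close> of the way from \<open>P\<close> to \<open>\<theta>\<close>.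
  Subgradients are monotone, so the slope \<open>gW \<bullet> (P - \<theta>)\<close> cannot exceed \<open>gP \<bullet> (P - \<theta>)\<close> by more than
  \<open>2 * G * \<epsilon>\<close>, even if the subgradients themselves are far apart.  That \<open>y - \<mu> * y\<^sup>2\<close>
  is increasing in the relevant range then carries the comparison over to the quadratic bound.
\<close>

lemma subgradient_rounding_transfer:
  fixes f :: "real ^ 'd \<Rightarrow> real"
  assumes gP: "gP \<in> subdifferential f P" "infnorm gP \<le> G"
    and gW: "gW \<in> subdifferential f W" "infnorm gW \<le> G"
    and ball: "P \<in> unit_ball_one" "W \<in> unit_ball_one" "\<theta> \<in> unit_ball_one"
    and close: "norm_one (W - ((1 - \<epsilon>) *\<^sub>R P + \<epsilon> *\<^sub>R \<theta>)) \<le> \<epsilon>\<^sup>2" and \<epsilon>: "0 < \<epsilon>" "\<epsilon> \<le> 1"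
    and \<mu>: "0 \<le> \<mu>" "4 * G * \<mu> \<le> 1"
  shows "f P - gP \<bullet> (P - \<theta>) + \<mu> * (gP \<bullet> (P - \<theta>))\<^sup>2
    \<le> f W - gW \<bullet> (W - \<theta>) + \<mu> * (gW \<bullet> (W - \<theta>))\<^sup>2 + 13 * G * \<epsilon>"
proof -
  define e where "e = W - ((1 - \<epsilon>) *\<^sub>R P + \<epsilon> *\<^sub>R \<theta>)"
  have W: "W - P = \<epsilon> *\<^sub>R (\<theta> - P) + e" by (simp add: e_def algebra_simps)
  have G: "0 \<le> G" using gP(2) infnorm_pos_le[of gP] by linarith
  have "norm_one (\<theta> - P) \<le> 2" using norm_one_diff_le[of \<theta> P] ball by (simp add: unit_ball_one_def)
  then have "norm_one (\<epsilon> *\<^sub>R (\<theta> - P)) \<le> 2 * \<epsilon>"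
    using \<epsilon> by (simp add: norm_one_scaleR)
  moreover have "\<epsilon>\<^sup>2 \<le> \<epsilon>" using \<epsilon> by (simp add: power2_eq_square mult_left_le)
  ultimately have WP: "norm_one (W - P) \<le> 3 * \<epsilon>"
    using norm_one_triangle[of "\<epsilon> *\<^sub>R (\<theta> - P)" e] close unfolding W by (simp add: e_def)
  have dP: "\<bar>gP \<bullet> (W - P)\<bar> \<le> G * (3 * \<epsilon>)" and dW: "\<bar>gW \<bullet> (W - P)\<bar> \<le> G * (3 * \<epsilon>)"
    using gP gW \<epsilon> by (auto intro!: abs_inner_le_norm_one WP)
  have fP: "f P + gP \<bullet> (W - P) \<le> f W" and fW: "f W - gW \<bullet> (W - P) \<le> f P"
    using gP(1) gW(1) by (auto simp: subdifferential_def inner_diff_right algebra_simps)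
  define y where "y = gP \<bullet> (P - \<theta>)"
  define y' where "y' = gW \<bullet> (W - \<theta>)"
  have yy: "y' \<le> y + 5 * G * \<epsilon>"
  proof -
    have "\<bar>gP \<bullet> e\<bar> \<le> G * \<epsilon>\<^sup>2" "\<bar>gW \<bullet> e\<bar> \<le> G * \<epsilon>\<^sup>2"
      using gP gW close by (auto intro!: abs_inner_le_norm_one simp: e_def)
    moreover have "gP \<bullet> (W - P) \<le> gW \<bullet> (W - P)" using fP fW by simp
    then have "\<epsilon> * (gW \<bullet> (P - \<theta>) - y) \<le> gW \<bullet> e - gP \<bullet> e"
      unfolding W by (simp add: y_def inner_add_right inner_diff_right algebra_simps)
    ultimately have "\<epsilon> * (gW \<bullet> (P - \<theta>) - y) \<le> \<epsilon> * (2 * G * \<epsilon>)"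
      by (simp add: power2_eq_square algebra_simps)
    then have "gW \<bullet> (P - \<theta>) - y \<le> 2 * G * \<epsilon>" using \<epsilon> by simp
    moreover have "y' = gW \<bullet> (P - \<theta>) + gW \<bullet> (W - P)"
      by (simp add: y'_def inner_diff_right)
    ultimately show ?thesis using dW by simp
  qed
  \<comment> \<open>\<open>y - \<mu> * y\<^sup>2\<close> is nondecreasing on \<open>[- 2 * G, 2 * G]\<close>, with slope at most 2.\<close>
  have "(y' - y) * (1 - \<mu> * (y' + y)) \<le> 10 * G * \<epsilon>"
  proof -
    have "\<bar>y\<bar> \<le> 2 * G" "\<bar>y'\<bar> \<le> 2 * G"
      unfolding y_def y'_def by (intro abs_inner_diff_le_unit_ball_one gP gW ball)+
    then have "\<bar>y' + y\<bar> \<le> 4 * G" by linarith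
    then have "\<bar>\<mu> * (y' + y)\<bar> \<le> \<mu> * (4 * G)"
      using \<mu> unfolding abs_mult by (intro mult_mono) auto
    then have s: "0 \<le> 1 - \<mu> * (y' + y)" "1 - \<mu> * (y' + y) \<le> 2" using \<mu> by (auto simp: mult_ac)
    have "(y' - y) * (1 - \<mu> * (y' + y)) \<le> (5 * G * \<epsilon>) * (1 - \<mu> * (y' + y))"
      using yy s by (intro mult_right_mono) auto
    also have "\<dots> \<le> (5 * G * \<epsilon>) * 2" using s G \<epsilon> by (intro mult_left_mono) auto
    finally show ?thesis by simp
  qed
  then have "y' - \<mu> * y'\<^sup>2 \<le> y - \<mu> * y\<^sup>2 + 10 * G * \<epsilon>"
    by (simp add: power2_eq_square algebra_simps)
  then show ?thesis using fP dP unfolding y_def[symmetric] y'_def[symmetric] by simp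
qed

lemma (in sigma_finite_subalgebra) real_cond_exp_sum_on:
  assumes "\<And>i. i \<in> I \<Longrightarrow> integrable M (f i)"
  shows "AE x in M. real_cond_exp M F (\<lambda>x. \<Sum>i\<in>I. f i x) x = (\<Sum>i\<in>I. real_cond_exp M F (f i) x)"
proof -
  define f' where "f' i = (if i \<in> I then f i else (\<lambda>_. 0))" for i
  have eqs: "(\<Sum>i\<in>I. f' i x) = (\<Sum>i\<in>I. f i x)"
    "(\<Sum>i\<in>I. real_cond_exp M F (f' i) x) = (\<Sum>i\<in>I. real_cond_exp M F (f i) x)" for x
    by (auto simp: f'_def)
  have "AE x in M. real_cond_exp M F (\<lambda>x. \<Sum>i\<in>I. f' i x) x = (\<Sum>i\<in>I. real_cond_exp M F (f' i) x)"
    by (rule real_cond_exp_sum) (auto simp: f'_def assms)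
  then show ?thesis unfolding eqs .
qed

text \<open>
  One round seen from its past \<open>F\<close>: the loss \<open>f\<close> with selected subgradients \<open>g\<close> is played at a
  prediction \<open>P\<close> which is known beforehand.
\<close>

locale convex_round = finite_measure_subalgebra M F
  for M F :: "'w measure" +
  fixes f :: "'w \<Rightarrow> real ^ 'd \<Rightarrow> real" and g :: "'w \<Rightarrow> real ^ 'd \<Rightarrow> real ^ 'd"
    and P :: "'w \<Rightarrow> real ^ 'd" and G :: real
  assumes f_measurable: "\<And>z. (\<lambda>\<omega>. f \<omega> z) \<in> borel_measurable M"
    and f_integrable: "\<And>z. z \<in> unit_ball_one \<Longrightarrow> integrable M (\<lambda>\<omega>. f \<omega> z)"
    and g_measurable: "(\<lambda>(\<omega>, z). g \<omega> z) \<in> borel_measurable (M \<Otimes>\<^sub>M borel)"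
    and f_convex: "\<And>\<omega>. \<omega> \<in> space M \<Longrightarrow> convex_on UNIV (f \<omega>)"
    and subgradient: "\<And>\<omega> z. \<omega> \<in> space M \<Longrightarrow> g \<omega> z \<in> subdifferential (f \<omega>) z"
    and g_bounded: "AE \<omega> in M. \<forall>z\<in>unit_ball_one. infnorm (g \<omega> z) \<le> G"
    and P_measurable: "P \<in> borel_measurable F"
    and P_ball: "\<And>\<omega>. \<omega> \<in> space M \<Longrightarrow> P \<omega> \<in> unit_ball_one"
begin

abbreviation "regret v \<omega> \<equiv> g \<omega> (P \<omega>) \<bullet> (P \<omega> - v)"

lemma P_measurable_M [measurable]: "P \<in> borel_measurable M"
  by (rule measurable_from_subalg[OF subalg P_measurable])

lemma g_measurable_at: "Q \<in> borel_measurable M \<Longrightarrow> (\<lambda>\<omega>. g \<omega> (Q \<omega>)) \<in> borel_measurable M"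
  using measurable_compose[OF measurable_Pair[OF measurable_ident_sets[OF refl]] g_measurable]
  by simp

lemma regret_measurable [measurable]: "regret v \<in> borel_measurable M"
  using g_measurable_at[OF P_measurable_M] by measurable

lemma regret_bounded:
  assumes "v \<in> unit_ball_one"
  shows "AE \<omega> in M. \<bar>regret v \<omega>\<bar> \<le> 2 * G"
  using g_bounded AE_space
  by eventually_elim (intro abs_inner_diff_le_unit_ball_one P_ball assms, auto simp: P_ball)

lemma regret_integrable: "v \<in> unit_ball_one \<Longrightarrow> integrable M (regret v)"
  using regret_bounded by (rule AE_bounded_integrable[OF regret_measurable])

lemma regret_sq_bounded:
  assumes "v \<in> unit_ball_one"
  shows "AE \<omega> in M. (regret v \<omega>)\<^sup>2 \<le> 4 * G\<^sup>2"
  using regret_bounded[OF assms]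
proof eventually_elim
  case (elim \<omega>)
  show ?case using power_mono[OF elim abs_ge_zero, of 2] by (simp add: power_mult_distrib)
qed

lemma regret_sq_integrable:
  assumes "v \<in> unit_ball_one"
  shows "integrable M (\<lambda>\<omega>. (regret v \<omega>)\<^sup>2)"
  by (rule AE_bounded_integrable[of _ "4 * G\<^sup>2"]) (use regret_sq_bounded[OF assms] in auto)

lemma fixed_point_slope:
  assumes "z \<in> unit_ball_one" "\<theta> \<in> unit_ball_one"
  shows "(\<lambda>\<omega>. g \<omega> z \<bullet> (z - \<theta>)) \<in> borel_measurable M"
    and "AE \<omega> in M. \<bar>g \<omega> z \<bullet> (z - \<theta>)\<bar> \<le> 2 * G"
    and "integrable M (\<lambda>\<omega>. g \<omega> z \<bullet> (z - \<theta>))"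
    and "integrable M (\<lambda>\<omega>. (g \<omega> z \<bullet> (z - \<theta>))\<^sup>2)"
proof -
  show [measurable]: "(\<lambda>\<omega>. g \<omega> z \<bullet> (z - \<theta>)) \<in> borel_measurable M"
    using g_measurable_at[of "\<lambda>_. z"] by measurable
  show bnd: "AE \<omega> in M. \<bar>g \<omega> z \<bullet> (z - \<theta>)\<bar> \<le> 2 * G"
    using g_bounded by eventually_elim (intro abs_inner_diff_le_unit_ball_one assms, auto simp: assms)
  then show "integrable M (\<lambda>\<omega>. g \<omega> z \<bullet> (z - \<theta>))" by (intro AE_bounded_integrable) auto
  show "integrable M (\<lambda>\<omega>. (g \<omega> z \<bullet> (z - \<theta>))\<^sup>2)"
  proof (rule AE_bounded_integrable[of _ "(2 * G)\<^sup>2"])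
    show "AE \<omega> in M. \<bar>(g \<omega> z \<bullet> (z - \<theta>))\<^sup>2\<bar> \<le> (2 * G)\<^sup>2"
      using bnd by eventually_elim (metis abs_ge_zero abs_power2 power2_abs power_mono)
  qed simp
qed

lemma f_at_P_integrable: "integrable M (\<lambda>\<omega>. f \<omega> (P \<omega>))"
proof -
  have [measurable]: "(\<lambda>\<omega>. f \<omega> (P \<omega>)) \<in> borel_measurable M"
    using f_measurable convex_on_continuous[OF open_UNIV f_convex] P_measurable_M P_ball compact_unit_ball_one
    by (rule borel_measurable_continuous_at_random_point)
  have "AE \<omega> in M. \<bar>f \<omega> (P \<omega>) - f \<omega> 0\<bar> \<le> G"
    using g_bounded AE_space
  proof eventually_elim
    case (elim \<omega>)
    have P: "P \<omega> \<in> unit_ball_one" "norm_one (P \<omega>) \<le> 1"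
      using P_ball elim by (auto simp: unit_ball_one_def)
    have "\<bar>g \<omega> z \<bullet> P \<omega>\<bar> \<le> G" if "z \<in> unit_ball_one" for z
      using elim(1) that abs_inner_le_norm_one[of "g \<omega> z" G "P \<omega>" 1] P(2) by simp
    from this[OF P(1)] this[OF zero_in_unit_ball_one]
    have "\<bar>g \<omega> (P \<omega>) \<bullet> P \<omega>\<bar> \<le> G" "\<bar>g \<omega> 0 \<bullet> P \<omega>\<bar> \<le> G" by blast+
    moreover have "f \<omega> (P \<omega>) - g \<omega> (P \<omega>) \<bullet> P \<omega> \<le> f \<omega> 0" "f \<omega> 0 + g \<omega> 0 \<bullet> P \<omega> \<le> f \<omega> (P \<omega>)"
      using subgradient[of \<omega> "P \<omega>"] subgradient[of \<omega> 0] elim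
      by (auto simp: subdifferential_def dest: spec[of _ 0] spec[of _ "P \<omega>"])
    ultimately show ?case by linarith
  qed
  then have "integrable M (\<lambda>\<omega>. f \<omega> (P \<omega>) - f \<omega> 0)"
    using f_measurable by (intro AE_bounded_integrable) auto
  from Bochner_Integration.integrable_add[OF this f_integrable[OF zero_in_unit_ball_one]]
  show ?thesis by simp
qed

lemma cond_exp_loss_le_regret:
  assumes \<theta>: "\<theta> \<in> unit_ball_one"
  shows "AE \<omega> in M. real_cond_exp M F (\<lambda>\<omega>. f \<omega> (P \<omega>)) \<omega> - real_cond_exp M F (\<lambda>\<omega>. f \<omega> \<theta>) \<omega>
    \<le> real_cond_exp M F (regret \<theta>) \<omega>"
proof -
  have "AE \<omega> in M. f \<omega> (P \<omega>) - f \<omega> \<theta> \<le> regret \<theta> \<omega>"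
    using AE_space
  proof eventually_elim
    case (elim \<omega>)
    then have "f \<omega> (P \<omega>) + g \<omega> (P \<omega>) \<bullet> (\<theta> - P \<omega>) \<le> f \<omega> \<theta>"
      using subgradient[of \<omega> "P \<omega>"] by (simp add: subdifferential_def)
    then show ?case by (simp add: inner_diff_right)
  qed
  then have "AE \<omega> in M. real_cond_exp M F (\<lambda>\<omega>. f \<omega> (P \<omega>) - f \<omega> \<theta>) \<omega> \<le> real_cond_exp M F (regret \<theta>) \<omega>"
    using f_at_P_integrable f_integrable[OF \<theta>] regret_integrable[OF \<theta>] by (intro real_cond_exp_mono) auto
  moreover have "AE \<omega> in M. real_cond_exp M F (\<lambda>\<omega>. f \<omega> (P \<omega>) - f \<omega> \<theta>) \<omega>
      = real_cond_exp M F (\<lambda>\<omega>. f \<omega> (P \<omega>)) \<omega> - real_cond_exp M F (\<lambda>\<omega>. f \<omega> \<theta>) \<omega>"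
    using f_at_P_integrable f_integrable[OF \<theta>] by (rule real_cond_exp_diff)
  ultimately show ?thesis by eventually_elim simp
qed

text \<open>
  Young's inequality under the conditional expectation.  Where the conditional expectation of
  \<open>inverse_power\<close> is infinite, the hypothesis is contradictory because its left-hand side is finite.
\<close>

lemma weak_exp_concavity_linearized:
  assumes ball: "z \<in> unit_ball_one" "\<theta> \<in> unit_ball_one"
    and param: "0 < \<alpha>" "0 \<le> \<beta>" "\<beta> \<le> 1" "0 < c" "0 \<le> \<mu>" "\<mu> \<le> \<alpha> * c powr (1 - \<beta>)"
    and wec: "AE \<omega> in M. ereal (real_cond_exp M F (\<lambda>\<omega>. f \<omega> z - f \<omega> \<theta>) \<omega>)
        \<le> ereal (real_cond_exp M F (\<lambda>\<omega>. g \<omega> z \<bullet> (z - \<theta>)) \<omega>)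
          - enn2ereal (nn_cond_exp M F (\<lambda>\<omega>. inverse_power \<beta> (\<alpha> * (g \<omega> z \<bullet> (z - \<theta>))\<^sup>2)) \<omega>)"
  shows "AE \<omega> in M. real_cond_exp M F
      (\<lambda>\<omega>. f \<omega> z - f \<omega> \<theta> - g \<omega> z \<bullet> (z - \<theta>) + \<mu> * (g \<omega> z \<bullet> (z - \<theta>))\<^sup>2 - c) \<omega> \<le> 0"
proof -
  let ?y = "\<lambda>\<omega>. g \<omega> z \<bullet> (z - \<theta>)"
  let ?N = "\<lambda>\<omega>. inverse_power \<beta> (\<alpha> * (?y \<omega>)\<^sup>2)"
  note y = fixed_point_slope[OF ball]
  have [measurable]: "?y \<in> borel_measurable M" by (rule y)
  have N[measurable]: "?N \<in> borel_measurable M"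
    using param by (intro measurable_inverse_power) auto
  have young: "ennreal (\<mu> * (?y \<omega>)\<^sup>2) \<le> ?N \<omega> + ennreal c" for \<omega>
  proof -
    have "\<mu> * (?y \<omega>)\<^sup>2 \<le> \<alpha> * c powr (1 - \<beta>) * (?y \<omega>)\<^sup>2" using param by (intro mult_right_mono) auto
    then have "ennreal (\<mu> * (?y \<omega>)\<^sup>2) \<le> ennreal (c powr (1 - \<beta>) * (\<alpha> * (?y \<omega>)\<^sup>2))"
      by (intro ennreal_leI) (simp add: mult_ac)
    also have "\<dots> \<le> ?N \<omega> + ennreal c" using param by (intro powr_mult_le_inverse_power) auto
    finally show ?thesis .
  qed
  have "AE \<omega> in M. nn_cond_exp M F (\<lambda>\<omega>. ennreal (\<mu> * (?y \<omega>)\<^sup>2)) \<omega> = ennreal (real_cond_exp M F (\<lambda>\<omega>. \<mu> * (?y \<omega>)\<^sup>2) \<omega>)"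
    using y(4) param by (intro nn_cond_exp_eq_real_cond_exp) auto
  moreover have "AE \<omega> in M. nn_cond_exp M F (\<lambda>\<omega>. ennreal (\<mu> * (?y \<omega>)\<^sup>2)) \<omega> \<le> nn_cond_exp M F (\<lambda>\<omega>. ?N \<omega> + ennreal c) \<omega>"
    using young by (intro nn_cond_exp_mono) auto
  moreover have "AE \<omega> in M. nn_cond_exp M F ?N \<omega> + nn_cond_exp M F (\<lambda>_. ennreal c) \<omega> = nn_cond_exp M F (\<lambda>\<omega>. ?N \<omega> + ennreal c) \<omega>"
    by (rule nn_cond_exp_sum) auto
  moreover have "AE \<omega> in M. ennreal c = nn_cond_exp M F (\<lambda>_. ennreal c) \<omega>"
    by (rule nn_cond_exp_F_meas) simp
  moreover have "AE \<omega> in M. real_cond_exp M F (\<lambda>\<omega>. f \<omega> z - f \<omega> \<theta> - ?y \<omega> + \<mu> * (?y \<omega>)\<^sup>2 - c) \<omega>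
      = real_cond_exp M F (\<lambda>\<omega>. f \<omega> z - f \<omega> \<theta> - ?y \<omega> + \<mu> * (?y \<omega>)\<^sup>2) \<omega> - real_cond_exp M F (\<lambda>_. c) \<omega>"
    using y f_integrable ball by (intro real_cond_exp_diff) auto
  moreover have "AE \<omega> in M. real_cond_exp M F (\<lambda>_. c) \<omega> = c"
    by (rule real_cond_exp_F_meas) auto
  moreover have "AE \<omega> in M. real_cond_exp M F (\<lambda>\<omega>. f \<omega> z - f \<omega> \<theta> - ?y \<omega> + \<mu> * (?y \<omega>)\<^sup>2) \<omega>
      = real_cond_exp M F (\<lambda>\<omega>. f \<omega> z - f \<omega> \<theta> - ?y \<omega>) \<omega> + real_cond_exp M F (\<lambda>\<omega>. \<mu> * (?y \<omega>)\<^sup>2) \<omega>"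
    using y f_integrable ball by (intro real_cond_exp_add) auto
  moreover have "AE \<omega> in M. real_cond_exp M F (\<lambda>\<omega>. f \<omega> z - f \<omega> \<theta> - ?y \<omega>) \<omega>
      = real_cond_exp M F (\<lambda>\<omega>. f \<omega> z - f \<omega> \<theta>) \<omega> - real_cond_exp M F ?y \<omega>"
    using y f_integrable ball by (intro real_cond_exp_diff) auto
  moreover have "AE \<omega> in M. 0 \<le> real_cond_exp M F (\<lambda>\<omega>. \<mu> * (?y \<omega>)\<^sup>2) \<omega>"
    using param by (intro real_cond_exp_pos) auto
  ultimately show ?thesis using wec
  proof eventually_elim
    case (elim \<omega>)
    let ?n = "nn_cond_exp M F ?N \<omega>"
    have "?n \<noteq> \<top>" using elim by (auto simp: enn2ereal_top)
    then obtain n where n: "?n = ennreal n" "0 \<le> n" by (cases ?n) auto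
    have "real_cond_exp M F (\<lambda>\<omega>. f \<omega> z - f \<omega> \<theta>) \<omega> \<le> real_cond_exp M F ?y \<omega> - n"
      using elim n by (simp add: enn2ereal_ennreal)
    moreover have "ennreal (real_cond_exp M F (\<lambda>\<omega>. \<mu> * (?y \<omega>)\<^sup>2) \<omega>) \<le> ennreal (n + c)"
      using elim n param by (simp add: ennreal_plus)
    then have "real_cond_exp M F (\<lambda>\<omega>. \<mu> * (?y \<omega>)\<^sup>2) \<omega> \<le> n + c"
      using n param by (subst (asm) ennreal_le_iff) auto
    ultimately show ?case using elim by linarith
  qed
qed

text \<open>
  The step from fixed points to the random prediction.  At a rounded point \<open>W\<close> the inequality holds
  because \<open>W\<close> is measurable with respect to \<open>F\<close> and has finitely many values, so that conditioning
  can be done separately on each event \<open>W = z\<close>.  The rounding error vanishes with \<open>\<epsilon>\<close>.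
\<close>

lemma cond_exp_excess_loss_le:
  assumes \<theta>: "\<theta> \<in> unit_ball_one" and \<mu>: "0 \<le> \<mu>" "4 * G * \<mu> \<le> 1"
    and fixed: "\<And>z. z \<in> unit_ball_one \<Longrightarrow> AE \<omega> in M. real_cond_exp M F
      (\<lambda>\<omega>. f \<omega> z - f \<omega> \<theta> - g \<omega> z \<bullet> (z - \<theta>) + \<mu> * (g \<omega> z \<bullet> (z - \<theta>))\<^sup>2 - c) \<omega> \<le> 0"
  shows "AE \<omega> in M. real_cond_exp M F (\<lambda>\<omega>. f \<omega> (P \<omega>)) \<omega> - real_cond_exp M F (\<lambda>\<omega>. f \<omega> \<theta>) \<omega>
    \<le> real_cond_exp M F (regret \<theta>) \<omega> - \<mu> * real_cond_exp M F (\<lambda>\<omega>. (regret \<theta> \<omega>)\<^sup>2) \<omega> + c"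
proof -
  define h where "h z \<omega> = f \<omega> z - f \<omega> \<theta> - g \<omega> z \<bullet> (z - \<theta>) + \<mu> * (g \<omega> z \<bullet> (z - \<theta>))\<^sup>2 - c" for z \<omega>
  define H where "H \<omega> = f \<omega> (P \<omega>) - f \<omega> \<theta> - regret \<theta> \<omega> + \<mu> * (regret \<theta> \<omega>)\<^sup>2 - c" for \<omega>
  have h_int: "integrable M (h z)" if "z \<in> unit_ball_one" for z
    unfolding h_def using fixed_point_slope[OF that \<theta>] f_integrable that \<theta> by auto
  have H_int: "integrable M H"
    unfolding H_def using f_at_P_integrable f_integrable \<theta> regret_integrable regret_sq_integrable by auto
  have approx: "AE \<omega> in M. real_cond_exp M F H \<omega> \<le> 13 * G * inverse (real (Suc n))" for n
  proof -
    \<comment> \<open>The net is finer than \<open>\<epsilon>\<^sup>2\<close> in the 1-norm, so that the displacement towards \<open>\<theta>\<close> dominates.\<close>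
    define \<epsilon> where "\<epsilon> = inverse (real (Suc n))"
    have \<epsilon>: "0 < \<epsilon>" "\<epsilon> \<le> 1" by (auto simp: \<epsilon>_def inverse_le_1_iff)
    define \<delta> where "\<delta> = \<epsilon>\<^sup>2 / real CARD('d)"
    have \<delta>: "0 < \<delta>" using \<epsilon> by (simp add: \<delta>_def)
    have ne: "(unit_ball_one :: (real ^ 'd) set) \<noteq> {}" using zero_in_unit_ball_one by blast
    obtain N q where N: "finite N" "N \<subseteq> (unit_ball_one :: (real ^ 'd) set)" "q \<in> borel_measurable borel"
      "range q \<subseteq> N" "\<And>z. z \<in> unit_ball_one \<Longrightarrow> dist (q z) z < \<delta>"
      using ex_measurable_finite_rounding[OF compact_unit_ball_one ne \<delta>] by blast
    define W where "W \<omega> = q ((1 - \<epsilon>) *\<^sub>R P \<omega> + \<epsilon> *\<^sub>R \<theta>)" for \<omega>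
    have W_F[measurable]: "W \<in> borel_measurable F"
    proof -
      have [measurable]: "P \<in> borel_measurable F" by (rule P_measurable)
      show ?thesis unfolding W_def by (rule measurable_compose[OF _ N(3)]) measurable
    qed
    have W_N: "W \<omega> \<in> N" for \<omega> using N(4) by (auto simp: W_def)
    have W_close: "norm_one (W \<omega> - ((1 - \<epsilon>) *\<^sub>R P \<omega> + \<epsilon> *\<^sub>R \<theta>)) \<le> \<epsilon>\<^sup>2" if "\<omega> \<in> space M" for \<omega>
    proof -
      let ?u = "(1 - \<epsilon>) *\<^sub>R P \<omega> + \<epsilon> *\<^sub>R \<theta>"
      have "?u \<in> unit_ball_one"
        using convexD[OF convex_unit_ball_one P_ball[OF that] \<theta>, of "1 - \<epsilon>" \<epsilon>] \<epsilon> by simp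
      then have "norm (W \<omega> - ?u) \<le> \<delta>" using N(5)[of ?u] by (simp add: W_def dist_norm)
      then have "real CARD('d) * norm (W \<omega> - ?u) \<le> real CARD('d) * \<delta>" by (intro mult_left_mono) auto
      then show ?thesis using norm_one_le_card_norm[of "W \<omega> - ?u"] by (simp add: \<delta>_def)
    qed
    have ind: "(\<lambda>\<omega>. indicator {z} (W \<omega>) :: real) \<in> borel_measurable F" for z by measurable
    have ind_int: "integrable M (\<lambda>\<omega>. indicator {z} (W \<omega>) * h z \<omega>)" if "z \<in> N" for z
    proof -
      have hz: "integrable M (h z)" using h_int N(2) that by auto
      have "(\<lambda>\<omega>. indicator {z} (W \<omega>) :: real) \<in> borel_measurable M"
        by (rule measurable_from_subalg[OF subalg ind])
      then show ?thesis
        using hz by (intro Bochner_Integration.integrable_bound[OF hz]) (auto simp: indicator_def)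
    qed
    have "AE \<omega> in M. H \<omega> \<le> (\<Sum>z\<in>N. indicator {z} (W \<omega>) * h z \<omega>) + 13 * G * \<epsilon>"
      using g_bounded AE_space
    proof eventually_elim
      case (elim \<omega>)
      have Wb: "W \<omega> \<in> unit_ball_one" using W_N N(2) by blast
      have "f \<omega> (P \<omega>) - regret \<theta> \<omega> + \<mu> * (regret \<theta> \<omega>)\<^sup>2
        \<le> f \<omega> (W \<omega>) - g \<omega> (W \<omega>) \<bullet> (W \<omega> - \<theta>) + \<mu> * (g \<omega> (W \<omega>) \<bullet> (W \<omega> - \<theta>))\<^sup>2 + 13 * G * \<epsilon>"
        using elim Wb P_ball
        by (intro subgradient_rounding_transfer subgradient \<theta> W_close \<epsilon> \<mu>) auto
      then have "H \<omega> \<le> h (W \<omega>) \<omega> + 13 * G * \<epsilon>" by (simp add: H_def h_def)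
      then show ?case using eq_sum_indicator[OF N(1) W_N, of "\<lambda>z. h z \<omega>" \<omega>] by simp
    qed
    then have "AE \<omega> in M. real_cond_exp M F H \<omega>
        \<le> real_cond_exp M F (\<lambda>\<omega>. (\<Sum>z\<in>N. indicator {z} (W \<omega>) * h z \<omega>) + 13 * G * \<epsilon>) \<omega>"
      using H_int ind_int by (intro real_cond_exp_mono) auto
    moreover have "AE \<omega> in M. real_cond_exp M F (\<lambda>\<omega>. (\<Sum>z\<in>N. indicator {z} (W \<omega>) * h z \<omega>) + 13 * G * \<epsilon>) \<omega>
        = real_cond_exp M F (\<lambda>\<omega>. \<Sum>z\<in>N. indicator {z} (W \<omega>) * h z \<omega>) \<omega> + real_cond_exp M F (\<lambda>_. 13 * G * \<epsilon>) \<omega>"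
      using ind_int by (intro real_cond_exp_add) auto
    moreover have "AE \<omega> in M. real_cond_exp M F (\<lambda>_. 13 * G * \<epsilon>) \<omega> = 13 * G * \<epsilon>"
      by (rule real_cond_exp_F_meas) auto
    moreover have "AE \<omega> in M. real_cond_exp M F (\<lambda>\<omega>. \<Sum>z\<in>N. indicator {z} (W \<omega>) * h z \<omega>) \<omega>
        = (\<Sum>z\<in>N. real_cond_exp M F (\<lambda>\<omega>. indicator {z} (W \<omega>) * h z \<omega>) \<omega>)"
      using ind_int by (rule real_cond_exp_sum_on)
    moreover have "AE \<omega> in M. \<forall>z\<in>N. real_cond_exp M F (\<lambda>\<omega>. indicator {z} (W \<omega>) * h z \<omega>) \<omega> \<le> 0"
    proof (rule AE_finite_allI[OF N(1)])
      fix z assume z: "z \<in> N"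
      then have zb: "z \<in> unit_ball_one" using N(2) by blast
      have "AE \<omega> in M. real_cond_exp M F (\<lambda>\<omega>. indicator {z} (W \<omega>) * h z \<omega>) \<omega>
          = indicator {z} (W \<omega>) * real_cond_exp M F (h z) \<omega>"
        using h_int[OF zb] by (intro real_cond_exp_mult ind ind_int z) auto
      moreover have "AE \<omega> in M. real_cond_exp M F (h z) \<omega> \<le> 0"
        using fixed[OF zb] by (simp add: h_def[abs_def])
      ultimately show "AE \<omega> in M. real_cond_exp M F (\<lambda>\<omega>. indicator {z} (W \<omega>) * h z \<omega>) \<omega> \<le> 0"
        by eventually_elim (auto simp: indicator_def)
    qed
    ultimately show ?thesis unfolding \<epsilon>_def
      by eventually_elim (smt (verit) sum_nonpos)
  qed
  have "AE \<omega> in M. \<forall>n. real_cond_exp M F H \<omega> \<le> 13 * G * inverse (real (Suc n))"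
    using approx by (simp add: AE_all_countable)
  then have H_le: "AE \<omega> in M. real_cond_exp M F H \<omega> \<le> 0"
  proof eventually_elim
    case (elim \<omega>)
    have "(\<lambda>n. 13 * G * inverse (real (Suc n))) \<longlonglongrightarrow> 13 * G * 0"
      by (intro tendsto_intros LIMSEQ_inverse_real_of_nat)
    then have "(\<lambda>n. 13 * G * inverse (real (Suc n))) \<longlonglongrightarrow> 0" by simp
    then show ?case by (rule LIMSEQ_le_const) (use elim in auto)
  qed
  let ?L = "\<lambda>\<omega>. f \<omega> (P \<omega>) - f \<omega> \<theta>"
  note ints = f_at_P_integrable f_integrable[OF \<theta>] regret_integrable[OF \<theta>] regret_sq_integrable[OF \<theta>]
  have "AE \<omega> in M. real_cond_exp M F H \<omega>
      = real_cond_exp M F (\<lambda>\<omega>. ?L \<omega> - regret \<theta> \<omega> + \<mu> * (regret \<theta> \<omega>)\<^sup>2) \<omega> - real_cond_exp M F (\<lambda>_. c) \<omega>"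
    unfolding H_def using ints by (intro real_cond_exp_diff) auto
  moreover have "AE \<omega> in M. real_cond_exp M F (\<lambda>_. c) \<omega> = c"
    by (rule real_cond_exp_F_meas) auto
  moreover have "AE \<omega> in M. real_cond_exp M F (\<lambda>\<omega>. ?L \<omega> - regret \<theta> \<omega> + \<mu> * (regret \<theta> \<omega>)\<^sup>2) \<omega>
      = real_cond_exp M F (\<lambda>\<omega>. ?L \<omega> - regret \<theta> \<omega>) \<omega> + real_cond_exp M F (\<lambda>\<omega>. \<mu> * (regret \<theta> \<omega>)\<^sup>2) \<omega>"
    using ints by (intro real_cond_exp_add) auto
  moreover have "AE \<omega> in M. real_cond_exp M F (\<lambda>\<omega>. \<mu> * (regret \<theta> \<omega>)\<^sup>2) \<omega>
      = \<mu> * real_cond_exp M F (\<lambda>\<omega>. (regret \<theta> \<omega>)\<^sup>2) \<omega>"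
    using ints by (intro real_cond_exp_cmult) auto
  moreover have "AE \<omega> in M. real_cond_exp M F (\<lambda>\<omega>. ?L \<omega> - regret \<theta> \<omega>) \<omega>
      = real_cond_exp M F ?L \<omega> - real_cond_exp M F (regret \<theta>) \<omega>"
    using ints by (intro real_cond_exp_diff) auto
  moreover have "AE \<omega> in M. real_cond_exp M F ?L \<omega>
      = real_cond_exp M F (\<lambda>\<omega>. f \<omega> (P \<omega>)) \<omega> - real_cond_exp M F (\<lambda>\<omega>. f \<omega> \<theta>) \<omega>"
    using ints by (intro real_cond_exp_diff) auto
  ultimately show ?thesis using H_le by eventually_elim linarith
qed

end

section \<open>Measurability of histories and predictions\<close>

lemma history_generators_subset:
  "(\<Union>s\<in>{1..t}. {(\<lambda>\<omega>. loss s \<omega> \<theta>) -` B \<inter> space M | \<theta> B. B \<in> sets borel} \<union>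
     {pred s -` B \<inter> space M | B. B \<in> sets borel}) \<subseteq> Pow (space M)"
  by auto

lemma space_history [simp]: "space (history M loss pred t) = space M"
  unfolding history_def by (rule space_measure_of[OF history_generators_subset])

lemma sets_history:
  "sets (history M loss pred t) = sigma_sets (space M)
     (\<Union>s\<in>{1..t}. {(\<lambda>\<omega>. loss s \<omega> \<theta>) -` B \<inter> space M | \<theta> B. B \<in> sets borel} \<union>
        {pred s -` B \<inter> space M | B. B \<in> sets borel})"
  unfolding history_def by (rule sets_measure_of[OF history_generators_subset])

lemma subalgebra_history:
  fixes loss :: "nat \<Rightarrow> 'w \<Rightarrow> real ^ 'd \<Rightarrow> real" and pred :: "nat \<Rightarrow> 'w \<Rightarrow> real ^ 'd"
  assumes "\<And>s \<theta>. s \<in> {1..t} \<Longrightarrow> (\<lambda>\<omega>. loss s \<omega> \<theta>) \<in> borel_measurable M"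
    and "\<And>s. s \<in> {1..t} \<Longrightarrow> pred s \<in> borel_measurable M"
  shows "subalgebra M (history M loss pred t)"
  unfolding subalgebra_def sets_history
  using assms by (auto intro!: sets.sigma_sets_subset measurable_sets)

lemma subalgebra_history_mono:
  assumes "s \<le> t"
  shows "subalgebra (history M loss pred t) (history M loss pred s)"
proof -
  have "{1..s} \<subseteq> {1..t}" using assms by auto
  then show ?thesis unfolding subalgebra_def sets_history space_history
    by (intro conjI refl sigma_sets_mono' UN_mono) auto
qed

lemma pred_measurable_history:
  fixes pred :: "nat \<Rightarrow> 'w \<Rightarrow> real ^ 'd"
  assumes "s \<in> {1..t}"
  shows "pred s \<in> borel_measurable (history M loss pred t)"
proof (rule measurableI)
  fix B :: "(real ^ 'd) set" assume "B \<in> sets borel"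
  then show "pred s -` B \<inter> space (history M loss pred t) \<in> sets (history M loss pred t)"
    unfolding sets_history space_history using assms by (intro sigma_sets.Basic) blast
qed simp

lemma squint_prediction_measurable:
  fixes grad :: "nat \<Rightarrow> 'w \<Rightarrow> real ^ 'd \<Rightarrow> real ^ 'd"
  assumes "finite \<Theta>"
    and grad: "\<And>t. 1 \<le> t \<Longrightarrow> (\<lambda>(\<omega>, \<theta>). grad t \<omega> \<theta>) \<in> borel_measurable (M \<Otimes>\<^sub>M borel)"
  shows "(\<lambda>\<omega>. squint_prediction \<Theta> E T \<pi>0 (\<lambda>s. grad s \<omega>) t) \<in> borel_measurable M"
proof (induction t rule: less_induct)
  case (less t)
  let ?P = "\<lambda>s \<omega>. squint_prediction \<Theta> E T \<pi>0 (\<lambda>s. grad s \<omega>) s"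
  have r: "(\<lambda>\<omega>. squint_regret \<Theta> E T \<pi>0 (\<lambda>s. grad s \<omega>) s v) \<in> borel_measurable M" if "s \<in> {1..t}" for s v
  proof -
    have P[measurable]: "?P (s - 1) \<in> borel_measurable M" using that by (intro less.IH) auto
    have [measurable]: "(\<lambda>\<omega>. grad s \<omega> (?P (s - 1) \<omega>)) \<in> borel_measurable M"
      using measurable_compose[OF measurable_Pair[OF measurable_ident_sets[OF refl] P] grad[of s]] that
      by simp
    show ?thesis unfolding squint_regret_def by measurable
  qed
  have "(\<lambda>\<omega>. squint_potential E T (squint_regret \<Theta> E T \<pi>0 (\<lambda>s. grad s \<omega>)) t v) \<in> borel_measurable M" for v
    unfolding squint_potential_def
    by (intro borel_measurable_sum borel_measurable_times borel_measurable_const borel_measurable_diff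
        borel_measurable_power measurable_compose[OF _ borel_measurable_exp] r)
  note [measurable] = this
  show ?case
    unfolding squint_prediction_eq squint_weight_def by (cases "t = 0"; simp)
qed

section \<open>Choice of the learning rate\<close>

text \<open>
  If \<open>D \<le> 1 / 2\<close>, then \<open>1 - D \<le> 2 * (1 - D)\<^sup>2\<close> and \<open>r\<close> is controlled by the combination and \<open>u\<close>.
  If \<open>D > 1 / 2\<close>, the last term alone is at least \<open>r\<^sup>2\<close>.
\<close>

lemma convex_combination_square_le:
  fixes D r u G :: real
  assumes D: "0 \<le> D" "D \<le> 1" and r: "\<bar>r\<bar> \<le> 2 * G" and u: "\<bar>u\<bar> \<le> 2 * G * D"
  shows "(1 - D) * r\<^sup>2 \<le> 4 * ((1 - D) * r + u)\<^sup>2 + 16 * D\<^sup>2 * G\<^sup>2"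
proof (cases "D \<le> 1 / 2")
  case True
  have "(1 - D) * r\<^sup>2 \<le> (2 * (1 - D)) * ((1 - D) * r\<^sup>2)"
    using mult_right_mono[of 1 "2 * (1 - D)" "(1 - D) * r\<^sup>2"] True D by simp
  also have "\<dots> = 2 * ((1 - D) * r)\<^sup>2" by (simp add: power2_eq_square)
  also have "\<dots> \<le> 4 * ((1 - D) * r + u)\<^sup>2 + 4 * u\<^sup>2"
  proof -
    define s where "s = (1 - D) * r"
    have "0 \<le> 2 * (s + 2 * u)\<^sup>2" by simp
    also have "\<dots> = 4 * (s + u)\<^sup>2 + 4 * u\<^sup>2 - 2 * s\<^sup>2" by (simp add: power2_eq_square algebra_simps)
    finally show ?thesis by (simp add: s_def)
  qed
  also have "u\<^sup>2 \<le> (2 * G * D)\<^sup>2" using power_mono[OF u abs_ge_zero, of 2] by simp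
  finally show ?thesis by (simp add: power_mult_distrib mult_ac)
next
  case False
  have r2: "r\<^sup>2 \<le> 4 * G\<^sup>2" using power_mono[OF r abs_ge_zero, of 2] by (simp add: power_mult_distrib)
  have "(1 - D) * r\<^sup>2 \<le> r\<^sup>2" using D by (intro mult_left_le_one_le) auto
  also have "\<dots> \<le> 16 * (1 / 2)\<^sup>2 * G\<^sup>2" using r2 by (simp add: power2_eq_square)
  also have "\<dots> \<le> 16 * D\<^sup>2 * G\<^sup>2" using False by (intro mult_right_mono mult_left_mono power_mono) auto
  finally show ?thesis by (meson add_increasing mult_nonneg_nonneg zero_le_numeral zero_le_power2)
qed

text \<open>
  Here \<open>A k\<close> and \<open>B k\<close> are the sums of the conditional means of the regret against \<open>k\<close> and of its
  square, \<open>Y1\<close> and \<open>Y2\<close> the same for the comparison point, and \<open>\<rho>\<close> is \<open>T\<close> times the risk.  Three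
  regimes occur.  For \<open>T < 2304 * a\<close> the trivial bound \<open>2 * G * T\<close> is of order \<open>a * G\<close>.  For
  \<open>l \<le> 12 * \<sigma>\<close> the slow rate \<open>G * sqrt (a / T)\<close> is at most \<open>12 * c\<close>, and it is attained with a rate close to
  \<open>\<sigma>\<close>.  Otherwise the ideal rate \<open>h\<close> is at least \<open>\<sigma>\<close>, hence inside the grid.
\<close>

lemma tuned_regret_bound:
  fixes A B :: "'k \<Rightarrow> real" and \<eta> :: "'i \<Rightarrow> real"
  assumes pos: "0 < G" "0 < T" "0 < a" "0 < c" "0 < l"
    and lc: "l * c = a / T"
    and \<sigma>: "\<sigma> = sqrt (a / T) / G"
    and D: "0 \<le> D" "D \<le> 1"
    and weights: "k0 \<in> K" "\<And>k. k \<in> K \<Longrightarrow> 0 \<le> p k" "sum p K = D"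
    and lin: "Y1 = (1 - D) * A k0 + (\<Sum>k\<in>K. p k * A k)"
    and sq: "(1 - D) * B k0 \<le> 4 * Y2 + 16 * D\<^sup>2 * G\<^sup>2 * T"
    and B: "\<And>k. k \<in> K \<Longrightarrow> B k \<le> 4 * G\<^sup>2 * T"
    and Y: "Y1 \<le> 2 * G * T" "0 \<le> Y2"
    and \<eta>: "\<And>i. i \<in> I \<Longrightarrow> 0 < \<eta> i"
    and reg: "\<And>k i. k \<in> K \<Longrightarrow> i \<in> I \<Longrightarrow> A k - 3 * \<eta> i * B k \<le> 4 * a / \<eta> i"
    and grid: "\<And>h. \<sigma> \<le> h \<Longrightarrow> h \<le> 1 / (48 * G) \<Longrightarrow> \<exists>i\<in>I. \<eta> i \<le> h \<and> h \<le> exp 1 * \<eta> i"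
    and slow: "\<rho> \<le> Y1"
    and fast: "\<rho> \<le> Y1 - min l (1 / (4 * G)) * Y2 + c * T"
  shows "\<rho> \<le> 5000 * (c * T + D * (G * sqrt (a * T)) + a * G)"
proof -
  define S where "S = G * sqrt (a * T)"
  have \<sigma>0: "0 < \<sigma>" using pos by (simp add: \<sigma>)
  have S: "\<sigma> * S = a" "\<sigma> * G\<^sup>2 * T = S" "0 < S"
    using pos by (simp_all add: \<sigma> S_def real_sqrt_mult real_sqrt_divide power2_eq_square field_simps)
  have cT: "c * T = a / l" using lc pos by (simp add: field_simps)
  have nonneg: "0 \<le> c * T" "0 \<le> D * S" "0 \<le> a * G" using pos D S by auto
  have A: "A k \<le> 12 * a / h + 3 * \<eta> i * B k" if "k \<in> K" "i \<in> I" "0 < h" "h \<le> exp 1 * \<eta> i" for k i h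
  proof -
    have "exp 1 * \<eta> i \<le> 3 * \<eta> i" using exp_le \<eta>[OF that(2)] by (intro mult_right_mono) auto
    then have "h \<le> 3 * \<eta> i" using that by simp
    then have "4 * a / \<eta> i \<le> 12 * a / h" using that \<eta>[of i] pos by (simp add: field_simps)
    then show ?thesis using reg[OF that(1,2)] by simp
  qed
  show ?thesis unfolding S_def[symmetric]
  proof (cases "T < 2304 * a")
    case True
    then have "2 * G * T \<le> 2 * G * (2304 * a)" using pos by (intro mult_left_mono) auto
    moreover have "2 * G * (2304 * a) = 4608 * (a * G)" by simp
    ultimately have "\<rho> \<le> 4608 * (a * G)" using slow Y by linarith
    then show "\<rho> \<le> 5000 * (c * T + D * S + a * G)" using nonneg by argo
  next
    case False
    have "a / T \<le> (1 / 48)\<^sup>2" using False pos by (simp add: field_simps power2_eq_square)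
    then have "sqrt (a / T) \<le> 1 / 48" by (intro real_le_lsqrt) auto
    then have \<sigma>_le: "\<sigma> \<le> 1 / (48 * G)" using pos by (simp add: \<sigma> field_simps)
    obtain j where j: "j \<in> I" "\<eta> j \<le> \<sigma>" "\<sigma> \<le> exp 1 * \<eta> j" using grid[OF order.refl \<sigma>_le] by blast
    \<comment> \<open>A rate of order \<open>\<sigma>\<close> balances \<open>a / \<eta>\<close> with \<open>\<eta> * G\<^sup>2 * T\<close>.\<close>
    have A_slow: "A k \<le> 24 * S" if "k \<in> K" for k
    proof -
      have "12 * a / \<sigma> = 12 * S" using S(1) \<sigma>0 by (simp add: field_simps)
      moreover have "3 * \<eta> j * B k \<le> 3 * \<sigma> * (4 * G\<^sup>2 * T)"
      proof -
        have "3 * \<eta> j * B k \<le> 3 * \<eta> j * (4 * G\<^sup>2 * T)"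
          using B[OF that] \<eta>[OF j(1)] by (intro mult_left_mono) auto
        also have "\<dots> \<le> 3 * \<sigma> * (4 * G\<^sup>2 * T)" using j pos by (intro mult_right_mono) auto
        finally show ?thesis .
      qed
      moreover have "3 * \<sigma> * (4 * G\<^sup>2 * T) = 12 * S" using S(2) by simp
      ultimately show ?thesis using A[OF that j(1) \<sigma>0 j(3)] by linarith
    qed
    have pA: "(\<Sum>k\<in>K. p k * A k) \<le> 24 * (D * S)"
    proof -
      have "(\<Sum>k\<in>K. p k * A k) \<le> (\<Sum>k\<in>K. p k * (24 * S))"
        using A_slow weights(2) by (intro sum_mono mult_left_mono) auto
      also have "\<dots> = 24 * (D * S)" by (simp add: sum_distrib_right[symmetric] weights(3))
      finally show ?thesis .
    qed
    show "\<rho> \<le> 5000 * (c * T + D * S + a * G)"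
    proof (cases "l \<le> 12 * \<sigma>")
      case True
      have "(1 - D) * A k0 \<le> (1 - D) * (24 * S)" using A_slow[OF weights(1)] D by (intro mult_left_mono) auto
      then have "Y1 \<le> 24 * S" using pA lin by (simp add: algebra_simps)
      moreover have "S \<le> 12 * (c * T)"
      proof -
        have "S * l \<le> S * (12 * \<sigma>)" using True S by (intro mult_left_mono) auto
        also have "\<dots> = 12 * a" using S(1) by (simp add: mult_ac)
        finally have "S \<le> 12 * a / l" using pos by (simp add: pos_le_divide_eq)
        then show ?thesis by (simp add: cT)
      qed
      ultimately show ?thesis using slow nonneg by argo
    next
      case False
      \<comment> \<open>The factors 48 and 12 give \<open>12 * \<eta> \<le> min l (1 / (4 * G))\<close>, as \<open>3 * \<eta>\<close> multiplies \<open>4 * Y2\<close>.\<close>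
      define h where "h = min (min (1 / (48 * G)) (l / 12)) (if D = 0 then 1 / (48 * G) else \<sigma> / D)"
      have "\<sigma> \<le> \<sigma> / D" if "D \<noteq> 0" using that D \<sigma>0 by (simp add: field_simps mult_left_le)
      then have \<sigma>h: "\<sigma> \<le> h" using False \<sigma>_le by (auto simp: h_def)
      then have h0: "0 < h" using \<sigma>0 by simp
      have h_le: "h \<le> 1 / (48 * G)" "h \<le> l / 12" by (auto simp: h_def)
      have hD: "h * D \<le> \<sigma>"
      proof (cases "D = 0")
        case False
        then have "h \<le> \<sigma> / D" by (simp add: h_def)
        then show ?thesis using False D by (simp add: field_simps)
      qed (use \<sigma>0 in simp)
      have inv_h: "a / h \<le> 48 * (a * G) + 12 * (c * T) + D * S"
      proof -
        have "h = 1 / (48 * G) \<or> h = l / 12 \<or> D \<noteq> 0 \<and> h = \<sigma> / D"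
          unfolding h_def min_def by (smt (verit))
        then consider "h = 1 / (48 * G)" | "h = l / 12" | "D \<noteq> 0" "h = \<sigma> / D" by blast
        then show ?thesis
        proof cases
          case 1
          then have "a / h = 48 * (a * G)" by simp
          then show ?thesis using nonneg by linarith
        next
          case 2
          have "a / h = 12 * (c * T)" unfolding cT 2 by simp
          then show ?thesis using nonneg by linarith
        next
          case 3
          have "a / h = (\<sigma> * S) / (\<sigma> / D)" by (simp only: 3(2) S(1))
          also have "\<dots> = D * S" using \<sigma>0 by simp
          finally have "a / h = D * S" .
          then show ?thesis using nonneg by linarith
        qed
      qed
      obtain i where i: "i \<in> I" "\<eta> i \<le> h" "h \<le> exp 1 * \<eta> i" using grid[OF \<sigma>h h_le(1)] by blast
      have \<eta>i: "0 < \<eta> i" by (rule \<eta>[OF i(1)])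
      have "(1 - D) * A k0 \<le> (1 - D) * (12 * a / h + 3 * \<eta> i * B k0)"
        using A[OF weights(1) i(1) h0 i(3)] D by (intro mult_left_mono) auto
      also have "\<dots> = (1 - D) * (12 * a / h) + 3 * \<eta> i * ((1 - D) * B k0)" by (simp add: algebra_simps)
      also have "\<dots> \<le> 12 * a / h + 3 * \<eta> i * (4 * Y2 + 16 * D\<^sup>2 * G\<^sup>2 * T)"
        using D pos h0 \<eta>i sq by (intro add_mono mult_left_mono mult_left_le_one_le) auto
      also have "\<dots> = 12 * (a / h) + (12 * \<eta> i) * Y2 + 48 * (D * ((\<eta> i * D) * G\<^sup>2 * T))"
        by (simp add: power2_eq_square algebra_simps)
      finally have Ak0: "(1 - D) * A k0 \<le> 12 * (a / h) + (12 * \<eta> i) * Y2 + 48 * (D * ((\<eta> i * D) * G\<^sup>2 * T))" .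
      have "D * ((\<eta> i * D) * G\<^sup>2 * T) \<le> D * (\<sigma> * G\<^sup>2 * T)"
        using order_trans[OF mult_right_mono[OF i(2) D(1)] hD] D pos
        by (intro mult_left_mono mult_right_mono) auto
      also have "\<dots> = D * S" by (simp add: S(2))
      finally have DS: "D * ((\<eta> i * D) * G\<^sup>2 * T) \<le> D * S" .
      have "12 * \<eta> i \<le> min l (1 / (4 * G))"
      proof -
        have "12 * \<eta> i \<le> 12 * (l / 12)" "12 * \<eta> i \<le> 12 * (1 / (48 * G))"
          using i(2) h_le by linarith+
        then show ?thesis by simp
      qed
      then have "(12 * \<eta> i) * Y2 \<le> min l (1 / (4 * G)) * Y2" using Y by (intro mult_right_mono)
      then show ?thesis using fast lin Ak0 DS pA inv_h nonneg by argo
    qed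
  qed
qed

section \<open>The risk bound\<close>

locale squint_online = prob_space M
  for M :: "'w measure" +
  fixes loss :: "nat \<Rightarrow> 'w \<Rightarrow> real ^ 'd \<Rightarrow> real" and grad :: "nat \<Rightarrow> 'w \<Rightarrow> real ^ 'd \<Rightarrow> real ^ 'd"
    and \<Theta> :: "(real ^ 'd) set" and G \<alpha> \<beta> x :: real and T :: nat
    and E :: real and pred :: "nat \<Rightarrow> 'w \<Rightarrow> real ^ 'd" and F :: "nat \<Rightarrow> 'w measure" and a :: real
  assumes x_pos: "0 < x" and T_pos: "1 \<le> T"
    and GT: "exp 1 \<le> G * real T" and GsqrtT: "1 \<le> G * sqrt (real T)"
    and finite_grid: "finite \<Theta>" and grid_ball: "\<Theta> \<subseteq> unit_ball_one"
    and vertices: "{\<theta>. norm_one \<theta> = 1 \<and> norm_zero \<theta> = 1} \<subseteq> \<Theta>"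
    and E_eq: "E = 8 * G / 3"
    and pred_eq: "pred = (\<lambda>t \<omega>. squint_prediction \<Theta> E T (uniform_weight \<Theta>) (\<lambda>s. grad s \<omega>) t)"
    and F_eq: "F = history M loss pred"
    and losses: "random_convex_losses M loss grad"
    and adapted: "\<And>t. t \<in> {1..T} \<Longrightarrow> (\<lambda>\<omega>. grad t \<omega> (pred (t - 1) \<omega>)) \<in> borel_measurable (F t)"
    and lipschitz: "lipschitz_losses M grad G"
    and \<alpha>_pos: "0 < \<alpha>" and \<beta>: "0 \<le> \<beta>" "\<beta> \<le> 1"
    and wec: "weakly_exp_concave M F loss grad \<alpha> \<beta>"
    and a_eq: "a = ln (real (card \<Theta>)) + ln (ln (G * real T)) + x"
begin

abbreviation "I \<equiv> rate_indices E T"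
abbreviation "\<eta> \<equiv> learning_rate E"

lemma G_pos: "0 < G"
  using GT T_pos exp_gt_zero[of "1 :: real"] by (metis less_le_trans of_nat_0_le_iff not_le zero_less_mult_iff less_le_not_le)

lemma E_pos: "0 < E"
  using G_pos by (simp add: E_eq)

lemma one_le_ln_GT: "1 \<le> ln (G * real T)"
proof -
  have "ln (exp 1) \<le> ln (G * real T)"
    using GT by (subst ln_le_cancel_iff) (auto intro: less_le_trans[OF exp_gt_zero])
  then show ?thesis by simp
qed

lemma ln_ET: "1 \<le> ln (E * real T)" "ln (E * real T) \<le> 2 * ln (G * real T)"
proof -
  have eq: "ln (E * real T) = ln (8 / 3) + ln (G * real T)"
  proof -
    have *: "E * real T = 8 / 3 * (G * real T)" by (simp add: E_eq)
    show ?thesis unfolding * using G_pos T_pos by (intro ln_mult_pos) auto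
  qed
  show "1 \<le> ln (E * real T)" using one_le_ln_GT ln_ge_zero[of "8 / 3 :: real"] unfolding eq by linarith
  have "8 / 3 \<le> exp (1 :: real)"
    using e_approx_32 by (simp add: abs_if split: if_splits)
  then have "ln (8 / 3 :: real) \<le> ln (exp 1)" by (subst ln_le_cancel_iff) auto
  then show "ln (E * real T) \<le> 2 * ln (G * real T)" using one_le_ln_GT unfolding eq by simp
qed

lemma rates_nonempty: "I \<noteq> {}"
  using ln_ET(1) by (auto simp: rate_indices_def intro!: exI[of _ 1])

lemma card_grid: "2 \<le> card \<Theta>" by (rule two_le_card_vertices[OF finite_grid vertices])

lemma grid_nonempty: "\<Theta> \<noteq> {}" using card_grid by auto

lemma half_le_a: "1 / 2 \<le> a"
proof -
  have "ln 2 \<le> ln (real (card \<Theta>))" using card_grid by (subst ln_le_cancel_iff) auto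
  moreover have "0 \<le> ln (ln (G * real T))" using one_le_ln_GT by simp
  ultimately show ?thesis using x_pos ln2_ge_two_thirds by (simp add: a_eq)
qed

text \<open>
  The left-hand side adds the logarithm paid in the regret bound to the one paid in the
  deviation bound.
\<close>

lemma log_card_le: "2 * ln (real (card \<Theta>) * real (card I)) + x \<le> 4 * a"
proof -
  have K: "0 < card \<Theta>" "0 < card I"
    using finite_grid grid_nonempty finite_rate_indices rates_nonempty by (auto simp: card_gt_0_iff)
  have "real (card I) \<le> 2 * ln (G * real T)"
    using card_rate_indices_le[of E T] ln_ET by simp
  then have "ln (real (card I)) \<le> ln (2 * ln (G * real T))"
    using K by (subst ln_le_cancel_iff) auto
  also have "\<dots> = ln 2 + ln (ln (G * real T))"
    using one_le_ln_GT by (intro ln_mult_pos) auto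
  finally have "ln (real (card I)) \<le> ln 2 + ln (ln (G * real T))" .
  moreover have "ln 2 \<le> ln (real (card \<Theta>))" using card_grid by (subst ln_le_cancel_iff) auto
  moreover have "0 \<le> ln (ln (G * real T))" using one_le_ln_GT by simp
  moreover have "ln (real (card \<Theta>) * real (card I)) = ln (real (card \<Theta>)) + ln (real (card I))"
    using K by (intro ln_mult_pos) auto
  ultimately show ?thesis using x_pos a_eq by argo
qed

lemma pred_in_ball: "pred t \<omega> \<in> unit_ball_one"
  using squint_prediction_in_convex_hull[OF finite_grid grid_nonempty E_pos rates_nonempty]
    hull_minimal[where S = convex, OF grid_ball convex_unit_ball_one]
  unfolding pred_eq by blast

lemma loss_measurable: "1 \<le> t \<Longrightarrow> (\<lambda>\<omega>. loss t \<omega> \<theta>) \<in> borel_measurable M"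
  using losses by (simp add: random_convex_losses_def)

lemma pred_measurable: "pred t \<in> borel_measurable M"
  unfolding pred_eq using losses
  by (intro squint_prediction_measurable finite_grid) (simp add: random_convex_losses_def)

lemma subalgebra_F: "subalgebra M (F t)"
  unfolding F_eq by (rule subalgebra_history) (auto intro: loss_measurable pred_measurable)

lemma subalgebra_F_mono: "s \<le> t \<Longrightarrow> subalgebra (F t) (F s)"
  unfolding F_eq by (rule subalgebra_history_mono)

text \<open>
  The prediction made before the first observation is constant, hence measurable for every
  \<open>\<sigma>\<close>-algebra although it does not occur in the history.
\<close>

lemma pred_measurable_F: "pred t \<in> borel_measurable (F t)"
proof (cases "t = 0")
  case True
  have "pred 0 = (\<lambda>\<omega>. \<Sum>\<theta>\<in>\<Theta>. uniform_weight \<Theta> \<theta> *\<^sub>R \<theta>)"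
    by (simp add: pred_eq squint_prediction_eq squint_weight_def)
  then show ?thesis using True by simp
qed (auto simp: F_eq intro!: pred_measurable_history)

lemma convex_round: "1 \<le> t \<Longrightarrow> convex_round M (F (t - 1)) (loss t) (grad t) (pred (t - 1)) G"
  using losses lipschitz pred_measurable_F[of "t - 1"] subalgebra_F pred_in_ball
  by unfold_locales (auto simp: random_convex_losses_def lipschitz_losses_def)

abbreviation "r t k \<omega> \<equiv> grad t \<omega> (pred (t - 1) \<omega>) \<bullet> (pred (t - 1) \<omega> - k)"
abbreviation "Er t k \<equiv> real_cond_exp M (F (t - 1)) (r t k)"
abbreviation "Er2 t k \<equiv> real_cond_exp M (F (t - 1)) (\<lambda>\<omega>. (r t k \<omega>)\<^sup>2)"

lemma regret_adapted: "t \<in> {1..T} \<Longrightarrow> r t k \<in> borel_measurable (F t)"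
proof -
  assume t: "t \<in> {1..T}"
  have [measurable]: "(\<lambda>\<omega>. grad t \<omega> (pred (t - 1) \<omega>)) \<in> borel_measurable (F t)" by (rule adapted[OF t])
  have [measurable]: "pred (t - 1) \<in> borel_measurable (F t)"
    by (rule measurable_from_subalg[OF subalgebra_F_mono pred_measurable_F]) simp
  show ?thesis by measurable
qed

lemma AE_all_rounds:
  assumes "\<And>t. t \<in> {1..T} \<Longrightarrow> AE \<omega> in M. Q t \<omega>"
  shows "AE \<omega> in M. \<forall>t\<in>{1..T}. Q t \<omega>"
  using assms by (intro AE_finite_allI) auto

lemma AE_all_rounds_and_grid:
  assumes "\<And>t k. t \<in> {1..T} \<Longrightarrow> k \<in> \<Theta> \<Longrightarrow> AE \<omega> in M. Q t k \<omega>"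
  shows "AE \<omega> in M. \<forall>t\<in>{1..T}. \<forall>k\<in>\<Theta>. Q t k \<omega>"
  using assms finite_grid by (intro AE_finite_allI) auto

text \<open>
  The pathwise regret bound and the deviation bound are added; the realised regrets and their squares
  cancel.
\<close>

lemma conditional_regret_event:
  obtains A where "A \<in> sets M" "1 - exp (- x) \<le> measure M A"
    "AE \<omega> in M. \<omega> \<in> A \<longrightarrow> (\<forall>k\<in>\<Theta>. \<forall>i\<in>I.
       (\<Sum>t\<in>{1..T}. Er t k \<omega>) - 3 * \<eta> i * (\<Sum>t\<in>{1..T}. Er2 t k \<omega>) \<le> 4 * a / \<eta> i)"
proof -
  let ?U = "\<lambda>(k, i) t \<omega>. \<eta> i * r t k \<omega>"
  have bnd: "AE \<omega> in M. \<bar>r t k \<omega>\<bar> \<le> 2 * G" if "t \<in> {1..T}" "k \<in> \<Theta>" for t k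
    using convex_round.regret_bounded[OF convex_round[of t], of k] that grid_ball by auto
  have J: "finite (\<Theta> \<times> I)" "\<Theta> \<times> I \<noteq> {}"
    using finite_grid finite_rate_indices grid_nonempty rates_nonempty by auto
  obtain A where A: "A \<in> sets M" "1 - exp (- x) \<le> measure M A"
    "\<And>\<omega> j. \<omega> \<in> A \<Longrightarrow> j \<in> \<Theta> \<times> I \<Longrightarrow>
       (\<Sum>s\<in>{1..T}. real_cond_exp M (F (s - 1)) (?U j s) \<omega> - ?U j s \<omega> + (?U j s \<omega>)\<^sup>2
          - 3 * real_cond_exp M (F (s - 1)) (\<lambda>\<omega>. (?U j s \<omega>)\<^sup>2) \<omega>) \<le> ln (real (card (\<Theta> \<times> I))) + x"
  proof (rule conditional_mean_deviation[of M "\<Theta> \<times> I" T F ?U x])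
    show "?U j s \<in> borel_measurable (F s)" if "j \<in> \<Theta> \<times> I" "s \<in> {1..T}" for j s
      using regret_adapted[OF that(2)] by (cases j) simp
    show "AE \<omega> in M. \<bar>?U j s \<omega>\<bar> \<le> 1 / 3" if "j \<in> \<Theta> \<times> I" "s \<in> {1..T}" for j s
    proof (cases j)
      case (Pair k i)
      then have "k \<in> \<Theta>" "i \<in> I" using that(1) by auto
      from bnd[OF that(2) this(1)] show ?thesis unfolding Pair prod.case
        by eventually_elim (rule abs_learning_rate_mult_le[OF \<open>i \<in> I\<close> E_eq G_pos])
    qed
  qed (use prob_space_axioms J subalgebra_F subalgebra_F_mono in blast)+
  have cond: "AE \<omega> in M. \<forall>t\<in>{1..T}. \<forall>k\<in>\<Theta>. \<forall>i\<in>I.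
      real_cond_exp M (F (t - 1)) (\<lambda>\<omega>. \<eta> i * r t k \<omega>) \<omega> = \<eta> i * Er t k \<omega> \<and>
      real_cond_exp M (F (t - 1)) (\<lambda>\<omega>. (\<eta> i * r t k \<omega>)\<^sup>2) \<omega> = (\<eta> i)\<^sup>2 * Er2 t k \<omega>"
  proof (rule AE_all_rounds_and_grid, rule AE_finite_allI[OF finite_rate_indices])
    fix t k i assume t: "t \<in> {1..T}" and k: "k \<in> \<Theta>"
    then interpret convex_round M "F (t - 1)" "loss t" "grad t" "pred (t - 1)" G
      by (intro convex_round) simp
    have "k \<in> unit_ball_one" using k grid_ball by blast
    then have "AE \<omega> in M. real_cond_exp M (F (t - 1)) (\<lambda>\<omega>. \<eta> i * r t k \<omega>) \<omega> = \<eta> i * Er t k \<omega>"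
      "AE \<omega> in M. real_cond_exp M (F (t - 1)) (\<lambda>\<omega>. (\<eta> i)\<^sup>2 * (r t k \<omega>)\<^sup>2) \<omega> = (\<eta> i)\<^sup>2 * Er2 t k \<omega>"
      using regret_integrable regret_sq_integrable by (intro real_cond_exp_cmult; blast)+
    then show "AE \<omega> in M. real_cond_exp M (F (t - 1)) (\<lambda>\<omega>. \<eta> i * r t k \<omega>) \<omega> = \<eta> i * Er t k \<omega> \<and>
      real_cond_exp M (F (t - 1)) (\<lambda>\<omega>. (\<eta> i * r t k \<omega>)\<^sup>2) \<omega> = (\<eta> i)\<^sup>2 * Er2 t k \<omega>"
      unfolding power_mult_distrib by eventually_elim simp
  qed
  have bnd_all: "AE \<omega> in M. \<forall>t\<in>{1..T}. \<forall>k\<in>\<Theta>. \<bar>r t k \<omega>\<bar> \<le> 2 * G"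
    by (rule AE_all_rounds_and_grid) (rule bnd)
  have scale: "X - 3 * e * Y \<le> b / e" if "0 < e" "e * X - 3 * (e\<^sup>2 * Y) \<le> b" for b e X Y :: real
  proof -
    have "(X - 3 * e * Y) * e \<le> b" using that(2) by (simp add: power2_eq_square algebra_simps)
    then show ?thesis using that(1) by (simp add: pos_le_divide_eq)
  qed
  have "AE \<omega> in M. \<omega> \<in> A \<longrightarrow> (\<forall>k\<in>\<Theta>. \<forall>i\<in>I.
       (\<Sum>t\<in>{1..T}. Er t k \<omega>) - 3 * \<eta> i * (\<Sum>t\<in>{1..T}. Er2 t k \<omega>) \<le> 4 * a / \<eta> i)"
    using cond bnd_all
  proof (eventually_elim, intro impI ballI)
    fix \<omega> k i
    assume c: "\<forall>t\<in>{1..T}. \<forall>k\<in>\<Theta>. \<forall>i\<in>I.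
        real_cond_exp M (F (t - 1)) (\<lambda>\<omega>. \<eta> i * r t k \<omega>) \<omega> = \<eta> i * Er t k \<omega> \<and>
        real_cond_exp M (F (t - 1)) (\<lambda>\<omega>. (\<eta> i * r t k \<omega>)\<^sup>2) \<omega> = (\<eta> i)\<^sup>2 * Er2 t k \<omega>"
      and b: "\<forall>t\<in>{1..T}. \<forall>k\<in>\<Theta>. \<bar>r t k \<omega>\<bar> \<le> 2 * G"
      and \<omega>: "\<omega> \<in> A" and k: "k \<in> \<Theta>" and i: "i \<in> I"
    let ?L = "ln (real (card \<Theta>) * real (card I))"
    have "(\<Sum>t\<in>{1..T}. \<eta> i * Er t k \<omega> - \<eta> i * r t k \<omega> + (\<eta> i * r t k \<omega>)\<^sup>2 - 3 * ((\<eta> i)\<^sup>2 * Er2 t k \<omega>))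
        = (\<Sum>s\<in>{1..T}. real_cond_exp M (F (s - 1)) (?U (k, i) s) \<omega> - ?U (k, i) s \<omega> + (?U (k, i) s \<omega>)\<^sup>2
          - 3 * real_cond_exp M (F (s - 1)) (\<lambda>\<omega>. (?U (k, i) s \<omega>)\<^sup>2) \<omega>)"
      using c k i by (intro sum.cong refl) auto
    also have "\<dots> \<le> ?L + x"
      using A(3)[OF \<omega>, of "(k, i)"] k i by (simp add: card_cartesian_product)
    finally have dev: "\<eta> i * (\<Sum>t\<in>{1..T}. Er t k \<omega>) - \<eta> i * (\<Sum>t\<in>{1..T}. r t k \<omega>)
        + (\<eta> i)\<^sup>2 * (\<Sum>t\<in>{1..T}. (r t k \<omega>)\<^sup>2) - 3 * ((\<eta> i)\<^sup>2 * (\<Sum>t\<in>{1..T}. Er2 t k \<omega>)) \<le> ?L + x"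
      by (simp only: sum.distrib sum_subtractf sum_distrib_left power_mult_distrib)
    have sr: "squint_regret \<Theta> E T (uniform_weight \<Theta>) (\<lambda>s. grad s \<omega>) t v = r t v \<omega>" for t v
      by (simp add: squint_regret_def pred_eq)
    have "\<eta> i * (\<Sum>t\<in>{1..T}. r t k \<omega>) - (\<eta> i)\<^sup>2 * (\<Sum>t\<in>{1..T}. (r t k \<omega>)\<^sup>2) \<le> ?L"
      using squint_regret_bound[OF finite_grid k i E_eq G_pos, of "\<lambda>s. grad s \<omega>"] b unfolding sr by blast
    then have "\<eta> i * (\<Sum>t\<in>{1..T}. Er t k \<omega>) - 3 * ((\<eta> i)\<^sup>2 * (\<Sum>t\<in>{1..T}. Er2 t k \<omega>)) \<le> 4 * a"
      using dev log_card_le by linarith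
    moreover have "0 < \<eta> i" by (rule learning_rate_pos[OF E_pos])
    ultimately show "(\<Sum>t\<in>{1..T}. Er t k \<omega>) - 3 * \<eta> i * (\<Sum>t\<in>{1..T}. Er2 t k \<omega>) \<le> 4 * a / \<eta> i"
      by (rule scale[rotated])
  qed
  then show thesis by (rule that[OF A(1,2)])
qed

text \<open>
  The assumption \<open>1 \<le> G * sqrt T\<close> keeps the slow rate above the lower end of the grid, and the factor
  48 keeps \<open>h\<close> below its upper end.
\<close>

lemma learning_rate_covers:
  assumes "sqrt (a / real T) / G \<le> h" "h \<le> 1 / (48 * G)"
  shows "\<exists>i\<in>I. \<eta> i \<le> h \<and> h \<le> exp 1 * \<eta> i"
proof -
  have "(1 / 2)\<^sup>2 \<le> a" using half_le_a by (simp add: power2_eq_square)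
  then have "1 / 2 \<le> sqrt a" by (rule real_le_rsqrt)
  then have "(1 / 2) * 1 \<le> sqrt a * (G * sqrt (real T))" using GsqrtT half_le_a by (intro mult_mono) auto
  then have "64 / 9 * (1 / 2) \<le> 64 / 9 * (sqrt a * (G * sqrt (real T)))" by (intro mult_left_mono) auto
  also have "\<dots> = E * E * real T * (sqrt (a / real T) / G)"
    using G_pos T_pos by (simp add: E_eq real_sqrt_divide field_simps)
  also have "\<dots> \<le> E * E * real T * h" using assms E_pos by (intro mult_left_mono) auto
  finally have 1: "exp 1 \<le> E * E * real T * h" using exp_le by linarith
  have "0 < sqrt (a / real T) / G" using half_le_a G_pos T_pos by simp
  then have h: "0 < h" using assms by linarith
  have "E * h \<le> E * (1 / (48 * G))" using assms E_pos by (intro mult_left_mono) auto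
  also have "\<dots> = 1 / 18" using G_pos by (simp add: E_eq)
  also have "\<dots> \<le> inverse (exp 1)" using exp_le by (simp add: inverse_eq_divide field_simps)
  finally have "E * h \<le> exp (- 1)" by (simp add: exp_minus)
  from ex_learning_rate_approx[OF E_pos h T_pos this 1] show ?thesis by metis
qed

text \<open>
  The conditional expectations are collected into finitely many almost sure inequalities in each
  round; summed over the rounds, they are the hypotheses of the deterministic tuning lemma.
\<close>

lemma average_risk_bound_on_event:
  assumes \<theta>: "\<theta> \<in> unit_ball_one"
  shows "AE \<omega> in M. (\<forall>k\<in>\<Theta>. \<forall>i\<in>I.
       (\<Sum>t\<in>{1..T}. Er t k \<omega>) - 3 * \<eta> i * (\<Sum>t\<in>{1..T}. Er2 t k \<omega>) \<le> 4 * a / \<eta> i) \<longrightarrow>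
     average_risk M F loss pred T \<theta> \<omega> \<le> 5000 * ((a / (\<alpha> * real T)) powr (1 / (2 - \<beta>))
         + G * accelerability_set \<theta> \<Theta> * sqrt (a / real T) + a * G / real T)"
proof -
  define D where "D = accelerability_set \<theta> \<Theta>"
  obtain k0 p where k0: "k0 \<in> \<Theta>" and D: "0 \<le> D" "D \<le> 1"
    and p: "\<And>k. k \<in> \<Theta> \<Longrightarrow> 0 \<le> p k" "sum p \<Theta> = D"
    and \<theta>_eq: "\<theta> = (1 - D) *\<^sub>R k0 + (\<Sum>k\<in>\<Theta>. p k *\<^sub>R k)"
    using accelerability_set_decomposition[OF finite_grid vertices \<theta>] unfolding D_def by blast
  define c where "c = (a / (\<alpha> * real T)) powr (1 / (2 - \<beta>))"
  define l where "l = \<alpha> * c powr (1 - \<beta>)"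
  have T0: "0 < real T" using T_pos by simp
  have a0: "0 < a" using half_le_a by linarith
  have c0: "0 < c" using a0 T0 \<alpha>_pos by (simp add: c_def)
  have l0: "0 < l" using c0 \<alpha>_pos by (simp add: l_def)
  have lc: "l * c = a / real T"
  proof -
    have "c powr (1 - \<beta>) * c = c powr (2 - \<beta>)" using c0 powr_add[of c "1 - \<beta>" 1] by simp
    also have "\<dots> = a / (\<alpha> * real T)" using \<beta> a0 T0 \<alpha>_pos by (simp add: c_def powr_powr)
    finally show ?thesis using \<alpha>_pos by (simp add: l_def mult.assoc)
  qed
  let ?\<mu> = "min l (1 / (4 * G))"
  let ?L = "\<lambda>t \<omega>. real_cond_exp M (F (t - 1)) (\<lambda>\<omega>. loss t \<omega> (pred (t - 1) \<omega>)) \<omega>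
      - real_cond_exp M (F (t - 1)) (\<lambda>\<omega>. loss t \<omega> \<theta>) \<omega>"
  have r_split: "r t \<theta> \<omega> = (1 - D) * r t k0 \<omega> + (\<Sum>k\<in>\<Theta>. p k * r t k \<omega>)" for t \<omega>
  proof -
    let ?P = "pred (t - 1) \<omega>"
    have "?P - \<theta> = (1 - D) *\<^sub>R (?P - k0) + (D *\<^sub>R ?P - (\<Sum>k\<in>\<Theta>. p k *\<^sub>R k))"
      unfolding \<theta>_eq by (simp add: algebra_simps)
    also have "D *\<^sub>R ?P - (\<Sum>k\<in>\<Theta>. p k *\<^sub>R k) = (\<Sum>k\<in>\<Theta>. p k *\<^sub>R (?P - k))"
      by (simp add: scaleR_diff_right sum_subtractf scaleR_sum_left[symmetric] p(2))
    finally show ?thesis by (simp add: inner_add_right inner_sum_right)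
  qed
  have "AE \<omega> in M. \<forall>t\<in>{1..T}. ?L t \<omega> \<le> Er t \<theta> \<omega> \<and> ?L t \<omega> \<le> Er t \<theta> \<omega> - ?\<mu> * Er2 t \<theta> \<omega> + c \<and>
      Er t \<theta> \<omega> = (1 - D) * Er t k0 \<omega> + (\<Sum>k\<in>\<Theta>. p k * Er t k \<omega>) \<and>
      (1 - D) * Er2 t k0 \<omega> \<le> 4 * Er2 t \<theta> \<omega> + 16 * D\<^sup>2 * G\<^sup>2 \<and>
      (\<forall>k\<in>\<Theta>. Er2 t k \<omega> \<le> 4 * G\<^sup>2) \<and> Er t \<theta> \<omega> \<le> 2 * G \<and> 0 \<le> Er2 t \<theta> \<omega>"
  proof (rule AE_all_rounds)
    fix t assume t: "t \<in> {1..T}"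
    then have t1: "1 \<le> t" by simp
    interpret R: convex_round M "F (t - 1)" "loss t" "grad t" "pred (t - 1)" G
      by (rule convex_round[OF t1])
    have kb: "k \<in> unit_ball_one" if "k \<in> \<Theta>" for k using that grid_ball by blast
    note int = R.regret_integrable[OF \<theta>] R.regret_sq_integrable[OF \<theta>]
      R.regret_integrable[OF kb] R.regret_sq_integrable[OF kb]
    have const: "AE \<omega> in M. real_cond_exp M (F (t - 1)) (\<lambda>_. b) \<omega> = b" for b
      by (rule R.real_cond_exp_F_meas) auto
    have 1: "AE \<omega> in M. ?L t \<omega> \<le> Er t \<theta> \<omega>" by (rule R.cond_exp_loss_le_regret[OF \<theta>])
    have 2: "AE \<omega> in M. ?L t \<omega> \<le> Er t \<theta> \<omega> - ?\<mu> * Er2 t \<theta> \<omega> + c"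
    proof (rule R.cond_exp_excess_loss_le[OF \<theta>])
      show "0 \<le> ?\<mu>" using l0 G_pos by simp
      show "4 * G * ?\<mu> \<le> 1" using mult_left_mono[of ?\<mu> "1 / (4 * G)" "4 * G"] G_pos by simp
      show "AE \<omega> in M. real_cond_exp M (F (t - 1)) (\<lambda>\<omega>. loss t \<omega> z - loss t \<omega> \<theta> - grad t \<omega> z \<bullet> (z - \<theta>)
          + ?\<mu> * (grad t \<omega> z \<bullet> (z - \<theta>))\<^sup>2 - c) \<omega> \<le> 0" if "z \<in> unit_ball_one" for z
        using wec t1 that \<theta> l0 G_pos
        by (intro R.weak_exp_concavity_linearized[OF that \<theta> \<alpha>_pos \<beta> c0])
           (auto simp: l_def weakly_exp_concave_def)
    qed
    have "AE \<omega> in M. real_cond_exp M (F (t - 1)) (\<lambda>\<omega>. (1 - D) * r t k0 \<omega> + (\<Sum>k\<in>\<Theta>. p k * r t k \<omega>)) \<omega>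
        = real_cond_exp M (F (t - 1)) (\<lambda>\<omega>. (1 - D) * r t k0 \<omega>) \<omega>
          + real_cond_exp M (F (t - 1)) (\<lambda>\<omega>. \<Sum>k\<in>\<Theta>. p k * r t k \<omega>) \<omega>"
      using int k0 by (intro R.real_cond_exp_add) auto
    moreover have "AE \<omega> in M. real_cond_exp M (F (t - 1)) (\<lambda>\<omega>. (1 - D) * r t k0 \<omega>) \<omega> = (1 - D) * Er t k0 \<omega>"
      using int k0 by (intro R.real_cond_exp_cmult) auto
    moreover have "AE \<omega> in M. real_cond_exp M (F (t - 1)) (\<lambda>\<omega>. \<Sum>k\<in>\<Theta>. p k * r t k \<omega>) \<omega>
        = (\<Sum>k\<in>\<Theta>. real_cond_exp M (F (t - 1)) (\<lambda>\<omega>. p k * r t k \<omega>) \<omega>)"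
      using int by (intro R.real_cond_exp_sum_on) auto
    moreover have "AE \<omega> in M. \<forall>k\<in>\<Theta>. real_cond_exp M (F (t - 1)) (\<lambda>\<omega>. p k * r t k \<omega>) \<omega> = p k * Er t k \<omega>"
      using int finite_grid by (intro AE_finite_allI R.real_cond_exp_cmult) auto
    ultimately have 3: "AE \<omega> in M. Er t \<theta> \<omega> = (1 - D) * Er t k0 \<omega> + (\<Sum>k\<in>\<Theta>. p k * Er t k \<omega>)"
      unfolding r_split by eventually_elim simp
    have "AE \<omega> in M. \<forall>k\<in>\<Theta>. \<bar>r t k \<omega>\<bar> \<le> 2 * G"
      using R.regret_bounded[OF kb] finite_grid by (intro AE_finite_allI) auto
    then have "AE \<omega> in M. (1 - D) * (r t k0 \<omega>)\<^sup>2 \<le> 4 * (r t \<theta> \<omega>)\<^sup>2 + 16 * D\<^sup>2 * G\<^sup>2"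
    proof eventually_elim
      case (elim \<omega>)
      have "\<bar>\<Sum>k\<in>\<Theta>. p k * r t k \<omega>\<bar> \<le> (\<Sum>k\<in>\<Theta>. p k * (2 * G))"
        using elim p by (intro order_trans[OF sum_abs] sum_mono) (auto simp: abs_mult intro!: mult_left_mono)
      also have "\<dots> = 2 * G * D" by (simp add: sum_distrib_right[symmetric] p(2))
      finally show ?case unfolding r_split[of t \<omega>]
        using elim k0 by (intro convex_combination_square_le D) auto
    qed
    then have "AE \<omega> in M. real_cond_exp M (F (t - 1)) (\<lambda>\<omega>. (1 - D) * (r t k0 \<omega>)\<^sup>2) \<omega>
        \<le> real_cond_exp M (F (t - 1)) (\<lambda>\<omega>. 4 * (r t \<theta> \<omega>)\<^sup>2 + 16 * D\<^sup>2 * G\<^sup>2) \<omega>"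
      using int k0 by (intro R.real_cond_exp_mono) auto
    moreover have "AE \<omega> in M. real_cond_exp M (F (t - 1)) (\<lambda>\<omega>. (1 - D) * (r t k0 \<omega>)\<^sup>2) \<omega> = (1 - D) * Er2 t k0 \<omega>"
      using int k0 by (intro R.real_cond_exp_cmult) auto
    moreover have "AE \<omega> in M. real_cond_exp M (F (t - 1)) (\<lambda>\<omega>. 4 * (r t \<theta> \<omega>)\<^sup>2 + 16 * D\<^sup>2 * G\<^sup>2) \<omega>
        = real_cond_exp M (F (t - 1)) (\<lambda>\<omega>. 4 * (r t \<theta> \<omega>)\<^sup>2) \<omega> + real_cond_exp M (F (t - 1)) (\<lambda>_. 16 * D\<^sup>2 * G\<^sup>2) \<omega>"
      using int by (intro R.real_cond_exp_add) auto
    moreover have "AE \<omega> in M. real_cond_exp M (F (t - 1)) (\<lambda>\<omega>. 4 * (r t \<theta> \<omega>)\<^sup>2) \<omega> = 4 * Er2 t \<theta> \<omega>"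
      using int by (intro R.real_cond_exp_cmult) auto
    moreover note const[of "16 * D\<^sup>2 * G\<^sup>2"]
    ultimately have 4: "AE \<omega> in M. (1 - D) * Er2 t k0 \<omega> \<le> 4 * Er2 t \<theta> \<omega> + 16 * D\<^sup>2 * G\<^sup>2"
      by eventually_elim simp
    have 5: "AE \<omega> in M. \<forall>k\<in>\<Theta>. Er2 t k \<omega> \<le> 4 * G\<^sup>2"
      using int R.regret_sq_bounded[OF kb] finite_grid
      by (intro AE_finite_allI R.real_cond_exp_le_c) auto
    have 6: "AE \<omega> in M. Er t \<theta> \<omega> \<le> 2 * G"
      using int R.regret_bounded[OF \<theta>]
      by (intro R.real_cond_exp_le_c) (auto elim!: eventually_mono)
    have 7: "AE \<omega> in M. 0 \<le> Er2 t \<theta> \<omega>"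
      using int by (intro R.real_cond_exp_pos) auto
    from 1 2 3 4 5 6 7
    show "AE \<omega> in M. ?L t \<omega> \<le> Er t \<theta> \<omega> \<and> ?L t \<omega> \<le> Er t \<theta> \<omega> - ?\<mu> * Er2 t \<theta> \<omega> + c \<and>
      Er t \<theta> \<omega> = (1 - D) * Er t k0 \<omega> + (\<Sum>k\<in>\<Theta>. p k * Er t k \<omega>) \<and>
      (1 - D) * Er2 t k0 \<omega> \<le> 4 * Er2 t \<theta> \<omega> + 16 * D\<^sup>2 * G\<^sup>2 \<and>
      (\<forall>k\<in>\<Theta>. Er2 t k \<omega> \<le> 4 * G\<^sup>2) \<and> Er t \<theta> \<omega> \<le> 2 * G \<and> 0 \<le> Er2 t \<theta> \<omega>"
      by eventually_elim blast
  qed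
  then show ?thesis
  proof (eventually_elim, intro impI)
    fix \<omega>
    assume round: "\<forall>t\<in>{1..T}. ?L t \<omega> \<le> Er t \<theta> \<omega> \<and> ?L t \<omega> \<le> Er t \<theta> \<omega> - ?\<mu> * Er2 t \<theta> \<omega> + c \<and>
        Er t \<theta> \<omega> = (1 - D) * Er t k0 \<omega> + (\<Sum>k\<in>\<Theta>. p k * Er t k \<omega>) \<and>
        (1 - D) * Er2 t k0 \<omega> \<le> 4 * Er2 t \<theta> \<omega> + 16 * D\<^sup>2 * G\<^sup>2 \<and>
        (\<forall>k\<in>\<Theta>. Er2 t k \<omega> \<le> 4 * G\<^sup>2) \<and> Er t \<theta> \<omega> \<le> 2 * G \<and> 0 \<le> Er2 t \<theta> \<omega>"
      and reg: "\<forall>k\<in>\<Theta>. \<forall>i\<in>I.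
        (\<Sum>t\<in>{1..T}. Er t k \<omega>) - 3 * \<eta> i * (\<Sum>t\<in>{1..T}. Er2 t k \<omega>) \<le> 4 * a / \<eta> i"
    define A where "A k = (\<Sum>t\<in>{1..T}. Er t k \<omega>)" for k
    define B where "B k = (\<Sum>t\<in>{1..T}. Er2 t k \<omega>)" for k
    define \<rho> where "\<rho> = (\<Sum>t\<in>{1..T}. ?L t \<omega>)"
    have "\<rho> \<le> 5000 * (c * real T + D * (G * sqrt (a * real T)) + a * G)"
    proof (rule tuned_regret_bound[where A = A and B = B and ?Y1.0 = "A \<theta>" and ?Y2.0 = "B \<theta>"
          and I = I and \<eta> = \<eta> and K = \<Theta> and p = p and l = l])
      show "\<rho> \<le> A \<theta>" unfolding \<rho>_def A_def using round by (intro sum_mono) blast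
      have "\<rho> \<le> (\<Sum>t\<in>{1..T}. Er t \<theta> \<omega> - ?\<mu> * Er2 t \<theta> \<omega> + c)"
        unfolding \<rho>_def using round by (intro sum_mono) blast
      then show "\<rho> \<le> A \<theta> - ?\<mu> * B \<theta> + c * real T"
        by (simp add: A_def B_def sum.distrib sum_subtractf sum_distrib_left mult.commute)
      have "A \<theta> = (\<Sum>t\<in>{1..T}. (1 - D) * Er t k0 \<omega> + (\<Sum>k\<in>\<Theta>. p k * Er t k \<omega>))"
        unfolding A_def using round by (intro sum.cong) auto
      also have "\<dots> = (1 - D) * A k0 + (\<Sum>t\<in>{1..T}. \<Sum>k\<in>\<Theta>. p k * Er t k \<omega>)"
        by (simp only: A_def sum.distrib sum_distrib_left)
      also have "(\<Sum>t\<in>{1..T}. \<Sum>k\<in>\<Theta>. p k * Er t k \<omega>) = (\<Sum>k\<in>\<Theta>. p k * A k)"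
        unfolding A_def sum_distrib_left by (rule sum.swap)
      finally show "A \<theta> = (1 - D) * A k0 + (\<Sum>k\<in>\<Theta>. p k * A k)" .
      have "(1 - D) * B k0 = (\<Sum>t\<in>{1..T}. (1 - D) * Er2 t k0 \<omega>)" by (simp only: B_def sum_distrib_left)
      also have "\<dots> \<le> (\<Sum>t\<in>{1..T}. 4 * Er2 t \<theta> \<omega> + 16 * D\<^sup>2 * G\<^sup>2)" using round by (intro sum_mono) blast
      also have "\<dots> = 4 * B \<theta> + 16 * D\<^sup>2 * G\<^sup>2 * real T"
        by (simp add: B_def sum.distrib sum_distrib_left mult_ac)
      finally show "(1 - D) * B k0 \<le> 4 * B \<theta> + 16 * D\<^sup>2 * G\<^sup>2 * real T" .
      show "B k \<le> 4 * G\<^sup>2 * real T" if "k \<in> \<Theta>" for k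
      proof -
        have "B k \<le> (\<Sum>t\<in>{1..T}. 4 * G\<^sup>2)" unfolding B_def using round that by (intro sum_mono) blast
        then show ?thesis by (simp add: mult.commute)
      qed
      have "A \<theta> \<le> (\<Sum>t\<in>{1..T}. 2 * G)" unfolding A_def using round by (intro sum_mono) blast
      then show "A \<theta> \<le> 2 * G * real T" by (simp add: mult.commute)
      show "0 \<le> B \<theta>" unfolding B_def using round by (intro sum_nonneg) blast
      show "A k - 3 * \<eta> i * B k \<le> 4 * a / \<eta> i" if "k \<in> \<Theta>" "i \<in> I" for k i
        using reg that by (simp add: A_def B_def)
      show "\<exists>i\<in>I. \<eta> i \<le> h \<and> h \<le> exp 1 * \<eta> i" if "sqrt (a / real T) / G \<le> h" "h \<le> 1 / (48 * G)" for h
        using that by (rule learning_rate_covers)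
    qed (use G_pos T0 a0 c0 l0 lc D k0 p learning_rate_pos[OF E_pos] in auto)
    then have "\<rho> / real T \<le> 5000 * (c * real T + D * (G * sqrt (a * real T)) + a * G) / real T"
      using T0 by (intro divide_right_mono) auto
    also have "\<dots> = 5000 * (c + G * D * sqrt (a / real T) + a * G / real T)"
    proof -
      have "sqrt (a * real T) / real T = sqrt (a / real T)"
        using T0 by (simp add: real_sqrt_mult real_sqrt_divide field_simps)
      moreover have "5000 * (c * real T + D * (G * q) + a * G) / real T
          = 5000 * (c + G * D * (q / real T) + a * G / real T)" for q
        using T0 by (simp add: field_simps)
      ultimately show ?thesis by (simp only:)
    qed
    also have "\<rho> / real T = average_risk M F loss pred T \<theta> \<omega>"
      by (simp add: \<rho>_def average_risk_def sum_subtractf diff_divide_distrib)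
    finally show "average_risk M F loss pred T \<theta> \<omega> \<le> 5000 * ((a / (\<alpha> * real T)) powr (1 / (2 - \<beta>))
         + G * accelerability_set \<theta> \<Theta> * sqrt (a / real T) + a * G / real T)"
      by (simp only: c_def D_def)
  qed
qed

lemma fast_rate:
  "with_probability_uniformly M (1 - exp (- x)) unit_ball_one
    (average_risk M F loss pred T)
    (\<lambda>\<theta>. 5000 * ((a / (\<alpha> * real T)) powr (1 / (2 - \<beta>))
              + G * accelerability_set \<theta> \<Theta> * sqrt (a / real T) + a * G / real T))"
proof -
  obtain A where A: "A \<in> sets M" "1 - exp (- x) \<le> measure M A"
    "AE \<omega> in M. \<omega> \<in> A \<longrightarrow> (\<forall>k\<in>\<Theta>. \<forall>i\<in>I.
       (\<Sum>t\<in>{1..T}. Er t k \<omega>) - 3 * \<eta> i * (\<Sum>t\<in>{1..T}. Er2 t k \<omega>) \<le> 4 * a / \<eta> i)"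
    by (rule conditional_regret_event)
  show ?thesis unfolding with_probability_uniformly_def
  proof (intro bexI[OF _ A(1)] conjI A(2) ballI)
    fix \<theta> :: "real ^ 'd" assume "\<theta> \<in> unit_ball_one"
    from average_risk_bound_on_event[OF this] A(3)
    show "AE \<omega> in M. \<omega> \<in> A \<longrightarrow> average_risk M F loss pred T \<theta> \<omega> \<le>
        5000 * ((a / (\<alpha> * real T)) powr (1 / (2 - \<beta>))
              + G * accelerability_set \<theta> \<Theta> * sqrt (a / real T) + a * G / real T)"
      by eventually_elim blast
  qed
qed

end

theorem theorem3p2:
  "\<exists>C::real. 0 < C \<and> C \<le> universal_cap \<and>
    (\<forall>(M :: 'w measure) (loss :: nat \<Rightarrow> 'w \<Rightarrow> real ^ 'd \<Rightarrow> real) grad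
       (\<Theta>0 :: (real ^ 'd) set) (G :: real) (\<alpha> :: real) (\<beta> :: real) (x :: real) (T :: nat) E pred F a.
      prob_space M \<longrightarrow>
      0 < x \<longrightarrow>
      1 \<le> T \<longrightarrow>
      exp 1 \<le> G * real T \<longrightarrow>
      1 \<le> G * sqrt (real T) \<longrightarrow>
      finite \<Theta>0 \<longrightarrow>
      \<Theta>0 \<subseteq> unit_ball_one \<longrightarrow>
      {\<theta>. norm_one \<theta> = 1 \<and> norm_zero \<theta> = 1} \<subseteq> \<Theta>0 \<longrightarrow>
      E = 8 * G / 3 \<longrightarrow>
      pred = (\<lambda>t \<omega>. squint_prediction \<Theta>0 E T (uniform_weight \<Theta>0) (\<lambda>s. grad s \<omega>) t) \<longrightarrow>
      F = history M loss pred \<longrightarrow>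
      random_convex_losses M loss grad \<longrightarrow>
      (\<forall>t\<in>{1..T}. (\<lambda>\<omega>. grad t \<omega> (pred (t - 1) \<omega>)) \<in> borel_measurable (F t)) \<longrightarrow>
      lipschitz_losses M grad G \<longrightarrow>
      0 < \<alpha> \<longrightarrow> 0 \<le> \<beta> \<longrightarrow> \<beta> \<le> 1 \<longrightarrow>
      weakly_exp_concave M F loss grad \<alpha> \<beta> \<longrightarrow>
      a = ln (real (card \<Theta>0)) + ln (ln (G * real T)) + x \<longrightarrow>
      with_probability_uniformly M (1 - exp (- x)) unit_ball_one
        (average_risk M F loss pred T)
        (\<lambda>\<theta>. C * ((a / (\<alpha> * real T)) powr (1 / (2 - \<beta>))
                  + G * accelerability_set \<theta> \<Theta>0 * sqrt (a / real T)
                  + a * G / real T)))"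
proof (intro exI[of _ 5000] conjI allI impI)
  show "(5000 :: real) \<le> universal_cap" by (simp add: universal_cap_def)
next
  fix M :: "'w measure" and loss :: "nat \<Rightarrow> 'w \<Rightarrow> real ^ 'd \<Rightarrow> real" and grad and \<Theta>0 :: "(real ^ 'd) set"
    and G \<alpha> \<beta> x :: real and T :: nat and E pred F a
  assume *: "prob_space M" "0 < x" "1 \<le> T" "exp 1 \<le> G * real T" "1 \<le> G * sqrt (real T)"
    "finite \<Theta>0" "\<Theta>0 \<subseteq> unit_ball_one" "{\<theta>. norm_one \<theta> = 1 \<and> norm_zero \<theta> = 1} \<subseteq> \<Theta>0"
    "E = 8 * G / 3"
    "pred = (\<lambda>t \<omega>. squint_prediction \<Theta>0 E T (uniform_weight \<Theta>0) (\<lambda>s. grad s \<omega>) t)"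
    "F = history M loss pred" "random_convex_losses M loss grad"
    "\<forall>t\<in>{1..T}. (\<lambda>\<omega>. grad t \<omega> (pred (t - 1) \<omega>)) \<in> borel_measurable (F t)"
    "lipschitz_losses M grad G" "0 < \<alpha>" "0 \<le> \<beta>" "\<beta> \<le> 1" "weakly_exp_concave M F loss grad \<alpha> \<beta>"
    "a = ln (real (card \<Theta>0)) + ln (ln (G * real T)) + x"
  interpret squint_online M loss grad \<Theta>0 G \<alpha> \<beta> x T E pred F a
    by (intro squint_online.intro squint_online_axioms.intro) (use * in blast)+
  show "with_probability_uniformly M (1 - exp (- x)) unit_ball_one (average_risk M F loss pred T)
        (\<lambda>\<theta>. 5000 * ((a / (\<alpha> * real T)) powr (1 / (2 - \<beta>))
                  + G * accelerability_set \<theta> \<Theta>0 * sqrt (a / real T)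
                  + a * G / real T))"
    by (rule fast_rate)
qed simp

end
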